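(* For every $E\in\mathcal A_4$ and every $\sigma\in\,]0,1]$, $\widetilde{\mathcal E}_{\infty,\sigma,E}$ is the only functional $\mathcal E:\mathbb R^{\mathcal F}\to[0,+\infty]$ satisfying the following: (a) $\mathcal E$ is lower semicontinuous on $\mathbb R^{\mathcal F}$ with respect to the $L_\infty$ (sup-norm) metric; (b) there exists a continuous function $\bar\theta:\mathbb R^{V^{(0)}}\to\,]0,+\infty[$ such that $\mathcal E(v)=\frac1\sigma\sum_{i=1}^k\mathcal E\big(\bar\theta(v|_{V^{(0)}})\,v\circ\psi_i\big)$ for every $v\in\mathbb R^{\mathcal F}$; (c) for every $u\in\mathbb R^{V^{(0)}}$ there exists $v\in\mathcal L'(\mathcal F,u)$ such that $E(u)=\mathcal E(v)=\min_{w\in\mathcal L(\mathcal F,u)}\mathcal E(w)$. (That is, $\widetilde{\mathcal E}_{\infty,\sigma,E}$ satisfies (a), (b), (c), and any functional satisfying (a), (b), (c) equals it.)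
   Context: Setting. Let $2\le N\le k$ be integers, $V^{(0)}=\{P_1,\dots,P_N\}$ a set of $N$ elements, and $\psi_1,\dots,\psi_k$ one-to-one maps defined on $V^{(0)}$; put $V^{(1)}=\bigcup_{i=1}^k\psi_i(V^{(0)})$. Assume $\psi_j(P_j)=P_j$ for $j=1,\dots,N$; $P_j\notin\psi_i(V^{(0)})$ for all $j=1,\dots,N$ and $i\ne j$; and $V^{(1)}$ is connected, i.e. for all $i,i'\in\{1,\dots,k\}$ there are indices $i_0=i,i_1,\dots,i_h=i'$ with $\psi_{i_{s-1}}(V^{(0)})\cap\psi_{i_s}(V^{(0)})\neq\emptyset$ for $s=1,\dots,h$. $\mathcal F$ is a fractal generated by these maps: a compact connected metric space with distance $d$ containing $V^{(0)}$, such that the $\psi_i$ extend to one-to-one maps $\mathcal F\to\mathcal F$ with $\mathcal F=\bigcup_{i=1}^k\psi_i(\mathcal F)$, $d(\psi_i(x),\psi_i(y))=\frac12 d(x,y)$ for all $x,y\in\mathcal F$, and, writing $\psi_{i_1,\dots,i_n}=\psi_{i_1}\circ\cdots\circ\psi_{i_n}$, $\psi_{i_1,\dots,i_n}(\mathcal F)\cap\psi_{i'_1,\dots,i'_n}(\mathcal F)=\psi_{i_1,\dots,i_n}(V^{(0)})\cap\psi_{i'_1,\dots,i'_n}(V^{(0)})$ whenever $(i_1,\dots,i_n)\neq(i'_1,\dots,i'_n)$. Put $V^{(n)}=\bigcup_{i_1,\dots,i_n=1}^k\psi_{i_1,\dots,i_n}(V^{(0)})$ and $V^{(\infty)}=\bigcup_nV^{(n)}$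 (the $V^{(n)}$ are increasing). $\mathbb R^{A}$ is the set of real functions on $A$, except that $\mathbb R^{\mathcal F}$ is the set of continuous functions $\mathcal F\to\mathbb R$. For $u\in\mathbb R^{V^{(0)}}$: $\mathcal L(u)=\{v\in\mathbb R^{V^{(1)}}: v=u\text{ on }V^{(0)}\}$, $\mathcal L(\mathcal F,u)=\{v\in\mathbb R^{\mathcal F}: v=u\text{ on }V^{(0)}\}$, $\mathcal L'(\mathcal F,u)=\{v\in\mathcal L(\mathcal F,u):\min u\le v\le\max u\}$. For $E:\mathbb R^{V^{(0)}}\to[0,+\infty[$ and $\theta>0$: $S_{(\theta)}(E)(v)=\sum_{i=1}^kE(\theta\, v\circ\psi_i)$ for $v\in\mathbb R^{V^{(1)}}$, and $\Lambda_{(\theta)}(E)(u)=\inf\{S_{(\theta)}(E)(v):v\in\mathcal L(u)\}$ for $u\in\mathbb R^{V^{(0)}}$. Class $\mathcal A_1$: all $E:\mathbb R^{V^{(0)}}\to[0,+\infty[$ such that (Q1) $E$ is convex; (Q2) $E(\pm u+c)=E(u)$ for every $u$ and every constant $c$; (Q3) $E(u)=0$ iff $u$ is constant; (Q4) for all real $a\ge b$, $E((u\wedge a)\vee b)\le E(u)$, with strict inequality if $u$ is nonconstant and $(u\wedge a)\vee b\ne u$. Class $\mathcal A_2$: all $E\in\mathcal A_1$ for which there exists $\widetilde E:\mathbb R^{V^{(0)}}\to[0,+\infty[$ such that: $\widetilde E$ satisfies (Q1)–(Q4) except possibly the strictness in (Q4); $\widetilde E$ is $p$-homogeneous for some $p>0$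 ($\widetilde E(tu)=|t|^p\widetilde E(u)$); there is $\rho>0$ with $\Lambda_{(1)}(\widetilde E)=\rho\widetilde E$; and $E(u)/\widetilde E(u)\to1$ as $u\to0$ ($u$ nonconstant). Class $\mathcal A_3$: all $E\in\mathcal A_1$ such that (Q5) if $u,v\in\mathbb R^{V^{(0)}}$, $v(P)\ge0$ for every $P$ with $u(P)=\min u$, and $v(P)=0$ for every $P$ with $u(P)>\min u$, then the right derivative $\frac{d}{dt}^{+}\big|_{t=0}E(u+tv)\le0$. Put $\mathcal A_4=\mathcal A_2\cap\mathcal A_3$. For $E\in\mathcal A_2$ and $\sigma>0$, $\bar\theta_{\sigma,E}:\mathbb R^{V^{(0)}}\to\,]0,+\infty[$ is the (continuous) function such that, for nonconstant $u$, $\bar\theta_{\sigma,E}(u)$ is the unique $\theta>0$ with $\Lambda_{(\theta)}(E)(u)=\sigma E(u)$, and $\bar\theta_{\sigma,E}(u)=(\sigma/\rho)^{1/p}$ for constant $u$. For $\bar\theta:\mathbb R^{V^{(0)}}\to\,]0,+\infty[$ continuous, define recursively for functions $v$ on $V^{(n)}$ or on a larger set: $\bar\theta_{,}(v)=1$ (empty index), $\bar\theta_{,i}(v)=\bar\theta(v|_{V^{(0)}})$, $\bar\theta_{,i_1,\dots,i_{n+1}}(v)=\bar\theta_{,i_2,\dots,i_{n+1}}\big(\bar\theta(v|_{V^{(0)}})\,v\circ\psi_{i_1}\big)\,\bar\theta(v|_{V^{(0)}})$. With $\bar\theta=\bar\theta_{\sigma,E}$ put $\widetilde{\mathcal E}_{n,\sigma,E}(v)=\frac1{\sigma^n}\sum_{i_1,\dots,i_n=1}^kE\big(\bar\theta_{,i_1,\dots,i_n}(v)\,v\circ\psi_{i_1,\dots,i_n}|_{V^{(0)}}\big)$.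 This sequence is nondecreasing in $n$, and $\widetilde{\mathcal E}_{\infty,\sigma,E}(v)=\lim_{n\to\infty}\widetilde{\mathcal E}_{n,\sigma,E}(v)\in[0,+\infty]$ for $v\in\mathbb R^{V^{(\infty)}}$, and for $v\in\mathbb R^{\mathcal F}$ via restriction to $V^{(\infty)}$. *)

theory Defs
  imports "HOL-Analysis.Analysis"
begin

text \<open>
  Conventions. The fractal is the whole type \<open>'a\<close>. The index sets \<open>{1..N}\<close> and \<open>{1..k}\<close> are the
  finite types \<open>'n\<close> and \<open>'k\<close>, and an injection \<open>\<iota>\<close> plays the role of the inclusion of the first in
  the second (so \<open>N \<le> k\<close>). The points of \<open>V\<^sup>(\<^sup>0\<^sup>)\<close> are the \<open>P j\<close>, and a real function on
  \<open>V\<^sup>(\<^sup>0\<^sup>)\<close> is the vector \<open>u :: real ^ 'n\<close> whose component \<open>u $ j\<close> is the value at \<open>P j\<close>.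
  The continuous real functions on the compact space \<open>'a\<close> form the type \<open>'a \<Rightarrow>\<^sub>C real\<close>, whose
  metric is the sup metric.
\<close>

section \<open>The fractal\<close>

fun word_map :: "('k \<Rightarrow> 'a \<Rightarrow> 'a) \<Rightarrow> 'k list \<Rightarrow> 'a \<Rightarrow> 'a" where
  "word_map \<psi> [] = id"
| "word_map \<psi> (i # w) = \<psi> i \<circ> word_map \<psi> w"

locale fractal =
  fixes P :: "'n::finite \<Rightarrow> 'a::metric_space"
    and \<iota> :: "'n \<Rightarrow> 'k::finite"
    and \<psi> :: "'k \<Rightarrow> 'a \<Rightarrow> 'a"
  assumes card_ge_2: "2 \<le> CARD('n)"
    and inj_P: "inj P"
    and inj_\<iota>: "inj \<iota>"
    and compact_space: "compact (UNIV :: 'a set)"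
    and connected_space: "connected (UNIV :: 'a set)"
    and inj_\<psi>: "inj (\<psi> i)"
    and fixed_point: "\<psi> (\<iota> j) (P j) = P j"
    and P_not_in_cell: "i \<noteq> \<iota> j \<Longrightarrow> P j \<notin> \<psi> i ` range P"
    and V1_connected: "(i, i') \<in> {(l, l'). \<psi> l ` range P \<inter> \<psi> l' ` range P \<noteq> {}}\<^sup>*"
    and self_similar_space: "(\<Union>i. range (\<psi> i)) = UNIV"
    and dist_\<psi>: "dist (\<psi> i x) (\<psi> i y) = 1 / 2 * dist x y"
    and cell_inter: "length w = length w' \<Longrightarrow> w \<noteq> w' \<Longrightarrow>
      range (word_map \<psi> w) \<inter> range (word_map \<psi> w')
        = word_map \<psi> w ` range P \<inter> word_map \<psi> w' ` range P"

definition V1 :: "('n \<Rightarrow> 'a) \<Rightarrow> ('k \<Rightarrow> 'a \<Rightarrow> 'a) \<Rightarrow> 'a set" where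
  "V1 P \<psi> = (\<Union>i. \<psi> i ` range P)"

text \<open>The restriction of a function to \<open>V\<^sup>(\<^sup>0\<^sup>)\<close>.\<close>

definition restr0 :: "('n::finite \<Rightarrow> 'a) \<Rightarrow> ('a \<Rightarrow> real) \<Rightarrow> real ^ 'n" where
  "restr0 P v = (\<chi> j. v (P j))"

text \<open>Composition of a continuous function with a self-map of the space. It has the expected
  values only if the self-map is continuous, as the maps of a fractal are.\<close>

definition bcomp :: "('a::topological_space \<Rightarrow>\<^sub>C real) \<Rightarrow> ('a \<Rightarrow> 'a) \<Rightarrow> ('a \<Rightarrow>\<^sub>C real)" where
  "bcomp v f = Bcontfun (apply_bcontfun v \<circ> f)"

lemma apply_bcomp:
  assumes "continuous_on UNIV f"
  shows "apply_bcontfun (bcomp v f) = apply_bcontfun v \<circ> f"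
proof -
  have "continuous_on UNIV (apply_bcontfun v \<circ> f)"
    by (rule continuous_on_compose[OF assms]) simp
  moreover have "bounded (range (apply_bcontfun v \<circ> f))"
    by (rule bounded_subset[OF bounded_apply_bcontfun[of v]]) auto
  ultimately show ?thesis
    by (simp add: bcomp_def Bcontfun_inverse bcontfun_def)
qed

lemma (in fractal) continuous_\<psi>: "continuous_on UNIV (\<psi> i)"
proof (rule continuous_onI)
  fix x :: 'a and e :: real
  assume "e > 0"
  then show "\<exists>d>0. \<forall>x'\<in>UNIV. dist x' x < d \<longrightarrow> dist (\<psi> i x') (\<psi> i x) \<le> e"
    by (intro exI[of _ e]) (auto simp: dist_\<psi>)
qed

section \<open>Extensions of boundary data\<close>

definition ext_V1 :: "('n::finite \<Rightarrow> 'a) \<Rightarrow> ('k \<Rightarrow> 'a \<Rightarrow> 'a) \<Rightarrow> real ^ 'n \<Rightarrow> ('a \<Rightarrow> real) set" where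
  "ext_V1 P \<psi> u = {v \<in> extensional (V1 P \<psi>). restr0 P v = u}"

definition ext_F :: "('n::finite \<Rightarrow> 'a::metric_space) \<Rightarrow> real ^ 'n \<Rightarrow> ('a \<Rightarrow>\<^sub>C real) set" where
  "ext_F P u = {v. restr0 P (apply_bcontfun v) = u}"

definition vmin :: "real ^ 'n::finite \<Rightarrow> real" where
  "vmin u = Min (range (($) u))"

definition vmax :: "real ^ 'n::finite \<Rightarrow> real" where
  "vmax u = Max (range (($) u))"

definition ext_F' :: "('n::finite \<Rightarrow> 'a::metric_space) \<Rightarrow> real ^ 'n \<Rightarrow> ('a \<Rightarrow>\<^sub>C real) set" where
  "ext_F' P u = {v \<in> ext_F P u. \<forall>x. vmin u \<le> v x \<and> v x \<le> vmax u}"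

section \<open>The renormalization operator\<close>

definition S_op ::
  "('n::finite \<Rightarrow> 'a) \<Rightarrow> ('k::finite \<Rightarrow> 'a \<Rightarrow> 'a) \<Rightarrow> real \<Rightarrow> (real ^ 'n \<Rightarrow> real) \<Rightarrow> ('a \<Rightarrow> real) \<Rightarrow> real"
where
  "S_op P \<psi> \<theta> E v = (\<Sum>i\<in>UNIV. E (\<theta> *\<^sub>R restr0 P (v \<circ> \<psi> i)))"

definition Lam ::
  "('n::finite \<Rightarrow> 'a) \<Rightarrow> ('k::finite \<Rightarrow> 'a \<Rightarrow> 'a) \<Rightarrow> real \<Rightarrow> (real ^ 'n \<Rightarrow> real) \<Rightarrow> real ^ 'n \<Rightarrow> real"
where
  "Lam P \<psi> \<theta> E u = (INF v\<in>ext_V1 P \<psi> u. S_op P \<psi> \<theta> E v)"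

section \<open>Classes of functionals\<close>

definition is_const :: "real ^ 'n::finite \<Rightarrow> bool" where
  "is_const u \<longleftrightarrow> (\<exists>c. u = vec c)"

definition clip :: "real \<Rightarrow> real \<Rightarrow> real ^ 'n::finite \<Rightarrow> real ^ 'n" where
  "clip a b u = (\<chi> j. max (min (u $ j) a) b)"

text \<open>Nonnegativity and (Q1)--(Q4), without the strictness clause of (Q4).\<close>

definition weak_A1 :: "(real ^ 'n::finite \<Rightarrow> real) set" where
  "weak_A1 = {E.
     (\<forall>u. 0 \<le> E u) \<and>
     convex_on UNIV E \<and>
     (\<forall>u c. E (u + vec c) = E u \<and> E (- u + vec c) = E u) \<and>
     (\<forall>u. E u = 0 \<longleftrightarrow> is_const u) \<and>
     (\<forall>u a b. b \<le> a \<longrightarrow> E (clip a b u) \<le> E u)}"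

definition class_A1 :: "(real ^ 'n::finite \<Rightarrow> real) set" where
  "class_A1 = {E \<in> weak_A1.
     \<forall>u a b. b \<le> a \<longrightarrow> \<not> is_const u \<longrightarrow> clip a b u \<noteq> u \<longrightarrow> E (clip a b u) < E u}"

text \<open>\<open>Et\<close> is a homogeneous functional \<open>\<widetilde>E\<close> as required in the definition of the second class,
  with degree \<open>p\<close> and eigenvalue \<open>\<rho>\<close>.\<close>

definition A2_witness ::
  "('n::finite \<Rightarrow> 'a) \<Rightarrow> ('k::finite \<Rightarrow> 'a \<Rightarrow> 'a) \<Rightarrow> (real ^ 'n \<Rightarrow> real) \<Rightarrow> (real ^ 'n \<Rightarrow> real)
    \<Rightarrow> real \<Rightarrow> real \<Rightarrow> bool"
where
  "A2_witness P \<psi> E Et p \<rho> \<longleftrightarrow>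
     Et \<in> weak_A1 \<and>
     0 < p \<and> (\<forall>t u. Et (t *\<^sub>R u) = \<bar>t\<bar> powr p * Et u) \<and>
     0 < \<rho> \<and> (\<forall>u. Lam P \<psi> 1 Et u = \<rho> * Et u) \<and>
     ((\<lambda>u. E u / Et u) \<longlongrightarrow> 1) (at 0 within {u. \<not> is_const u})"

definition class_A2 ::
  "('n::finite \<Rightarrow> 'a) \<Rightarrow> ('k::finite \<Rightarrow> 'a \<Rightarrow> 'a) \<Rightarrow> (real ^ 'n \<Rightarrow> real) set"
where
  "class_A2 P \<psi> = {E \<in> class_A1. \<exists>Et p \<rho>. A2_witness P \<psi> E Et p \<rho>}"

text \<open>(Q5) asks for a sign of the right derivative; for a convex \<open>E\<close> that derivative always
  exists.\<close>

definition class_A3 :: "(real ^ 'n::finite \<Rightarrow> real) set" where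
  "class_A3 = {E \<in> class_A1.
     \<forall>u v. (\<forall>j. u $ j = vmin u \<longrightarrow> 0 \<le> v $ j) \<and> (\<forall>j. u $ j > vmin u \<longrightarrow> v $ j = 0) \<longrightarrow>
       (\<exists>D. ((\<lambda>t. E (u + t *\<^sub>R v)) has_real_derivative D) (at_right 0) \<and> D \<le> 0)}"

definition class_A4 ::
  "('n::finite \<Rightarrow> 'a) \<Rightarrow> ('k::finite \<Rightarrow> 'a \<Rightarrow> 'a) \<Rightarrow> (real ^ 'n \<Rightarrow> real) set"
where
  "class_A4 P \<psi> = class_A2 P \<psi> \<inter> class_A3"

section \<open>The limit energy\<close>

text \<open>For \<open>E\<close> in the second class the witness is unique: by homogeneity and the limit at \<open>0\<close>, the
  functional \<open>E\<close> determines \<open>p\<close> and \<open>Et\<close>, hence \<open>\<rho>\<close>. So the value on constants depends on \<open>E\<close>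
  and \<open>\<sigma>\<close> only.\<close>

definition theta_bar ::
  "('n::finite \<Rightarrow> 'a) \<Rightarrow> ('k::finite \<Rightarrow> 'a \<Rightarrow> 'a) \<Rightarrow> real \<Rightarrow> (real ^ 'n \<Rightarrow> real) \<Rightarrow> real ^ 'n \<Rightarrow> real"
where
  "theta_bar P \<psi> \<sigma> E u =
     (if is_const u then (THE \<theta>. \<exists>Et p \<rho>. A2_witness P \<psi> E Et p \<rho> \<and> \<theta> = (\<sigma> / \<rho>) powr (1 / p))
      else (THE \<theta>. 0 < \<theta> \<and> Lam P \<psi> \<theta> E u = \<sigma> * E u))"

text \<open>The factors of the recursive scaling along a word. The single-letter case of the recursion is
  the second equation with \<open>w = []\<close>.\<close>

fun theta_word ::
  "('n::finite \<Rightarrow> 'a) \<Rightarrow> ('k \<Rightarrow> 'a \<Rightarrow> 'a) \<Rightarrow> (real ^ 'n \<Rightarrow> real) \<Rightarrow> 'k list \<Rightarrow> ('a \<Rightarrow> real) \<Rightarrow> real"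
where
  "theta_word P \<psi> \<theta> [] v = 1"
| "theta_word P \<psi> \<theta> (i # w) v =
     theta_word P \<psi> \<theta> w (\<lambda>x. \<theta> (restr0 P v) * v (\<psi> i x)) * \<theta> (restr0 P v)"

definition energy_n ::
  "('n::finite \<Rightarrow> 'a) \<Rightarrow> ('k::finite \<Rightarrow> 'a \<Rightarrow> 'a) \<Rightarrow> nat \<Rightarrow> real \<Rightarrow> (real ^ 'n \<Rightarrow> real)
    \<Rightarrow> ('a \<Rightarrow> real) \<Rightarrow> real"
where
  "energy_n P \<psi> n \<sigma> E v =
     1 / \<sigma> ^ n * (\<Sum>w | length w = n.
       E (theta_word P \<psi> (theta_bar P \<psi> \<sigma> E) w v *\<^sub>R restr0 P (v \<circ> word_map \<psi> w)))"

definition energy_inf ::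
  "('n::finite \<Rightarrow> 'a::metric_space) \<Rightarrow> ('k::finite \<Rightarrow> 'a \<Rightarrow> 'a) \<Rightarrow> real \<Rightarrow> (real ^ 'n \<Rightarrow> real)
    \<Rightarrow> ('a \<Rightarrow>\<^sub>C real) \<Rightarrow> ennreal"
where
  "energy_inf P \<psi> \<sigma> E v = lim (\<lambda>n. ennreal (energy_n P \<psi> n \<sigma> E v))"

section \<open>The characterizing properties\<close>

definition lower_semicontinuous :: "('b::topological_space \<Rightarrow> ennreal) \<Rightarrow> bool" where
  "lower_semicontinuous f \<longleftrightarrow> (\<forall>x. f x \<le> Liminf (at x) f)"

definition self_similar_energy ::
  "('n::finite \<Rightarrow> 'a::metric_space) \<Rightarrow> ('k::finite \<Rightarrow> 'a \<Rightarrow> 'a) \<Rightarrow> real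
    \<Rightarrow> (('a \<Rightarrow>\<^sub>C real) \<Rightarrow> ennreal) \<Rightarrow> bool"
where
  "self_similar_energy P \<psi> \<sigma> \<E> \<longleftrightarrow>
     (\<exists>\<theta> :: real ^ 'n \<Rightarrow> real. continuous_on UNIV \<theta> \<and> (\<forall>u. 0 < \<theta> u) \<and>
       (\<forall>v. \<E> v = ennreal (1 / \<sigma>) * (\<Sum>i\<in>UNIV. \<E> (\<theta> (restr0 P v) *\<^sub>R bcomp v (\<psi> i)))))"

definition minimal_extension ::
  "('n::finite \<Rightarrow> 'a::metric_space) \<Rightarrow> (real ^ 'n \<Rightarrow> real) \<Rightarrow> (('a \<Rightarrow>\<^sub>C real) \<Rightarrow> ennreal) \<Rightarrow> bool"
where
  "minimal_extension P E \<E> \<longleftrightarrow>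
     (\<forall>u. \<exists>v\<in>ext_F' P u. ennreal (E u) = \<E> v \<and> (\<forall>w\<in>ext_F P u. \<E> v \<le> \<E> w))"

definition characterizing ::
  "('n::finite \<Rightarrow> 'a::metric_space) \<Rightarrow> ('k::finite \<Rightarrow> 'a \<Rightarrow> 'a) \<Rightarrow> real \<Rightarrow> (real ^ 'n \<Rightarrow> real)
    \<Rightarrow> (('a \<Rightarrow>\<^sub>C real) \<Rightarrow> ennreal) \<Rightarrow> bool"
where
  "characterizing P \<psi> \<sigma> E \<E> \<longleftrightarrow>
     lower_semicontinuous \<E> \<and> self_similar_energy P \<psi> \<sigma> \<E> \<and> minimal_extension P E \<E>"

end

theory Submission
  imports Defs
begin

text \<open>
  Let \<open>renorm E u\<close> be the least energy \<open>\<Sum>\<^sub>i E (v \<circ> \<psi> i)\<close> of an extension \<open>v\<close> of \<open>u\<close> to \<open>V\<^sup>(\<^sup>1\<^sup>)\<close>. The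
  function \<open>t \<mapsto> renorm E (t u)\<close> is convex, vanishes at \<open>0\<close> and, by connectedness of \<open>V\<^sup>(\<^sup>1\<^sup>)\<close>, is
  positive for \<open>t > 0\<close> and nonconstant \<open>u\<close>; so there is exactly one \<open>\<theta>(u) > 0\<close> with
  \<open>renorm E (\<theta>(u) u) = \<sigma> E(u)\<close>, and it depends continuously on \<open>u\<close>. Near the constants the continuity
  comes from the homogeneous functional \<open>\<widetilde>E\<close> with eigenvalue \<open>\<rho>\<close>, to which \<open>E\<close> is asymptotic:
  there \<open>\<theta>\<close> tends to \<open>(\<sigma> / \<rho>) powr (1 / p)\<close> (\<open>continuous_theta_bar\<close>).

  Existence. By the equation for \<open>\<theta>\<close>, passing from one level of cells to the next does not decrease the
  discrete energies, and they remain equal to \<open>E(u)\<close> if minimizers for the rescaled data are inserted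
  in cell after cell. The limit energy is therefore a supremum of continuous functionals, hence lower
  semicontinuous, and self-similarity passes to the limit. What needs work is that the values so
  inserted extend to a continuous function, that is, that their oscillation on the cells of level \<open>n\<close>
  tends to \<open>0\<close> uniformly (\<open>decay_potential\<close>). Two mechanisms are combined. First, by (Q5) and
  strictness in (Q4) a minimizer oscillates on each cell strictly less than its boundary data
  (\<open>minimizer_osc_less\<close>), and by compactness the contraction is uniform as long as the oscillation of
  the rescaled data stays away from \<open>0\<close> and \<open>\<infinity>\<close>; it stays bounded because \<open>\<sigma> \<le> 1\<close> keeps the energies
  of the rescaled data bounded. Secondly, where the rescaled data are nearly constant, one step multiplies
  the energy by at most \<open>\<sigma>\<close> but the scale by about \<open>(\<sigma> / \<rho>) powr (1 / p)\<close>, so the energy measured in the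
  original scale decays like \<open>\<rho>\<close>. Here \<open>\<rho> < 1\<close> (\<open>witness_eigenvalue_less_1\<close>), since (Q5) at the
  constants forces \<open>p > 1\<close>.

  Uniqueness. Minimizing in the self-similarity relation of another functional \<open>\<E>\<close> shows that its scaling
  factor satisfies the equation that determines \<open>\<theta>\<close> (\<open>scaling_factor_unique\<close>). Iterating the relation
  and using that \<open>E\<close> is the least value of \<open>\<E>\<close> for given boundary values bounds \<open>\<E>\<close> from below by all
  discrete energies. Conversely, if \<open>v\<close> is replaced inside the cells of level \<open>n\<close> by functions of
  least energy \<open>\<E>\<close>, the result has as energy exactly the discrete energy of \<open>v\<close> and converges uniformly
  to \<open>v\<close>, so lower semicontinuity gives the other inequality.
\<close>

section \<open>Oscillation of a vector\<close>

definition osc :: "real ^ 'n::finite \<Rightarrow> real" where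
  "osc u = vmax u - vmin u"

lemma vmin_le: "vmin u \<le> u $ j"
  unfolding vmin_def by (rule Min_le) auto

lemma vmax_ge: "u $ j \<le> vmax u"
  unfolding vmax_def by (rule Max_ge) auto

lemma vmin_attained: "\<exists>j. u $ j = vmin u"
proof -
  have "vmin u \<in> range (($) u)"
    unfolding vmin_def by (rule Min_in) auto
  then show ?thesis by auto
qed

lemma vmax_attained: "\<exists>j. u $ j = vmax u"
proof -
  have "vmax u \<in> range (($) u)"
    unfolding vmax_def by (rule Max_in) auto
  then show ?thesis by auto
qed

lemma vmin_eqI: "(\<And>j. c \<le> u $ j) \<Longrightarrow> u $ j0 = c \<Longrightarrow> vmin u = c"
  by (metis order_antisym vmin_attained vmin_le)

lemma vmax_eqI: "(\<And>j. u $ j \<le> c) \<Longrightarrow> u $ j0 = c \<Longrightarrow> vmax u = c"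
  by (metis order_antisym vmax_attained vmax_ge)

lemma vmin_le_vmax: "vmin u \<le> vmax u"
  using vmin_le vmax_ge order_trans by blast

lemma osc_nonneg: "0 \<le> osc u"
  using vmin_le_vmax[of u] by (simp add: osc_def)

lemma osc_le_bound:
  assumes "\<And>j. a \<le> u $ j" "\<And>j. u $ j \<le> b"
  shows "osc u \<le> b - a"
  using assms vmin_attained[of u] vmax_attained[of u] unfolding osc_def by (metis diff_mono)

lemma vmin_vec [simp]: "vmin (vec c) = c" and vmax_vec [simp]: "vmax (vec c) = c"
  by (auto intro!: vmin_eqI vmax_eqI)

lemma vmin_add_vec: "vmin (u + vec c) = vmin u + c"
proof -
  obtain j where "u $ j = vmin u" using vmin_attained by blast
  then show ?thesis by (intro vmin_eqI[of _ _ j]) (auto simp: vmin_le)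
qed

lemma vmax_add_vec: "vmax (u + vec c) = vmax u + c"
proof -
  obtain j where "u $ j = vmax u" using vmax_attained by blast
  then show ?thesis by (intro vmax_eqI[of _ _ j]) (auto simp: vmax_ge)
qed

lemma vmin_scaleR: "0 \<le> t \<Longrightarrow> vmin (t *\<^sub>R u) = t * vmin u"
proof -
  assume t: "0 \<le> t"
  obtain j where "u $ j = vmin u" using vmin_attained by blast
  then show ?thesis by (intro vmin_eqI[of _ _ j]) (auto simp: vmin_le t mult_left_mono)
qed

lemma vmax_scaleR: "0 \<le> t \<Longrightarrow> vmax (t *\<^sub>R u) = t * vmax u"
proof -
  assume t: "0 \<le> t"
  obtain j where "u $ j = vmax u" using vmax_attained by blast
  then show ?thesis by (intro vmax_eqI[of _ _ j]) (auto simp: vmax_ge t mult_left_mono)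
qed

lemma vmin_uminus: "vmin (- u) = - vmax u"
proof -
  obtain j where "u $ j = vmax u" using vmax_attained by blast
  then show ?thesis by (intro vmin_eqI[of _ _ j]) (auto simp: vmax_ge)
qed

lemma vmax_uminus: "vmax (- u) = - vmin u"
  using vmin_uminus[of "- u"] by simp

lemma osc_uminus [simp]: "osc (- u) = osc u"
  by (simp add: osc_def vmin_uminus vmax_uminus)

lemma osc_add_vec [simp]: "osc (u + vec c) = osc u"
  by (simp add: osc_def vmin_add_vec vmax_add_vec)

lemma osc_diff_vec [simp]: "osc (u - vec c) = osc u"
  using osc_add_vec[of "u - vec c" c] by simp

lemma osc_scaleR: "0 \<le> t \<Longrightarrow> osc (t *\<^sub>R u) = t * osc u"
  by (simp add: osc_def vmin_scaleR vmax_scaleR right_diff_distrib)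

lemma is_const_iff_osc: "is_const u \<longleftrightarrow> osc u = 0"
proof
  assume "is_const u"
  then show "osc u = 0" by (auto simp: is_const_def osc_def)
next
  assume "osc u = 0"
  then have "u $ j = vmin u" for j
    using vmin_le[of u j] vmax_ge[of u j] by (simp add: osc_def)
  then have "u = vec (vmin u)" by (simp add: vec_eq_iff)
  then show "is_const u" unfolding is_const_def by blast
qed

lemma osc_pos_iff: "0 < osc u \<longleftrightarrow> \<not> is_const u"
  using osc_nonneg[of u] by (auto simp: is_const_iff_osc)

lemma is_const_vec [simp]: "is_const (vec c)"
  by (auto simp: is_const_def)

lemma is_const_zero [simp]: "is_const 0"
  by (simp add: is_const_iff_osc osc_def) (metis vec_0 vmin_vec vmax_vec)

lemma is_const_scaleR [simp]: "is_const (t *\<^sub>R u) \<longleftrightarrow> t = 0 \<or> is_const u"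
proof (cases "t \<ge> 0")
  case True
  then show ?thesis by (auto simp: is_const_iff_osc osc_scaleR)
next
  case False
  then have "osc (t *\<^sub>R u) = (- t) * osc u"
    using osc_uminus[of "t *\<^sub>R u"] osc_scaleR[of "- t" u] by simp
  with False show ?thesis by (auto simp: is_const_iff_osc)
qed

lemma vmin_normalized: "vmin (u - vec (vmin u)) = 0"
  using vmin_add_vec[of u "- vmin u"] by (metis add.right_inverse diff_conv_add_uminus vec_neg)

lemma vmin_lipschitz: "\<bar>vmin u - vmin v\<bar> \<le> norm (u - v)"
proof -
  have *: "vmin u \<le> vmin v + norm (u - v)" for u v :: "real ^ 'a"
  proof -
    obtain j where "v $ j = vmin v" using vmin_attained by blast
    then show ?thesis
      using vmin_le[of u j] component_le_norm_cart[of "u - v" j] by simp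
  qed
  show ?thesis using *[of u v] *[of v u] by (simp add: norm_minus_commute abs_le_iff)
qed

lemma continuous_on_vmin [continuous_intros]:
  assumes "continuous_on S f"
  shows "continuous_on S (\<lambda>x. vmin (f x))"
proof -
  have "1-lipschitz_on UNIV (vmin :: real ^ 'b \<Rightarrow> real)"
    by (rule lipschitz_onI) (use vmin_lipschitz in \<open>auto simp: dist_norm\<close>)
  then have "continuous_on UNIV (vmin :: real ^ 'b \<Rightarrow> real)"
    by (rule lipschitz_on_continuous_on)
  then show ?thesis
    using assms by (rule continuous_on_compose2) auto
qed

lemma continuous_on_vmax [continuous_intros]:
  assumes "continuous_on S f"
  shows "continuous_on S (\<lambda>x. vmax (f x))"
proof -
  have "vmax (f x) = - vmin (- f x)" for x by (simp add: vmin_uminus)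
  then show ?thesis using assms by (auto intro!: continuous_intros)
qed

lemma continuous_on_osc [continuous_intros]:
  "continuous_on S f \<Longrightarrow> continuous_on S (\<lambda>x. osc (f x))"
  unfolding osc_def by (intro continuous_intros)

lemma norm_le_osc: "vmin u = 0 \<Longrightarrow> norm u \<le> real CARD('n) * osc u" for u :: "real ^ 'n::finite"
proof -
  assume "vmin u = 0"
  then have "\<bar>u $ j\<bar> \<le> osc u" for j
    using vmin_le[of u j] vmax_ge[of u j] by (simp add: osc_def)
  then have "(\<Sum>j\<in>UNIV. \<bar>u $ j\<bar>) \<le> (\<Sum>j\<in>(UNIV :: 'n set). osc u)" by (intro sum_mono) auto
  then show ?thesis using norm_le_l1_cart[of u] by simp
qed

text \<open>The functionals are invariant under the addition of constants; normalizing the minimum to \<open>0\<close>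
  makes the vectors of bounded oscillation a compact set.\<close>

lemma compact_normalized_annulus: "compact {u :: real ^ 'n::finite. vmin u = 0 \<and> a \<le> osc u \<and> osc u \<le> b}"
proof -
  have "closed {u :: real ^ 'n. vmin u = 0 \<and> a \<le> osc u \<and> osc u \<le> b}"
    by (intro closed_Collect_conj closed_Collect_eq closed_Collect_le continuous_intros)
  moreover have "bounded {u :: real ^ 'n. vmin u = 0 \<and> a \<le> osc u \<and> osc u \<le> b}"
    unfolding bounded_iff
    by (rule exI[of _ "real CARD('n) * b"])
       (use norm_le_osc in \<open>fastforce intro: order_trans mult_left_mono\<close>)
  ultimately show ?thesis by (simp add: compact_eq_bounded_closed)
qed

section \<open>Convex functionals modulo constants\<close>

lemma weak_A1D:
  assumes "E \<in> weak_A1"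
  shows "0 \<le> E u" "convex_on UNIV E" "E (u + vec c) = E u" "E (- u) = E u"
    "E u = 0 \<longleftrightarrow> is_const u" "b \<le> a \<Longrightarrow> E (clip a b u) \<le> E u"
proof -
  have "E (- u + vec 0) = E u" using assms unfolding weak_A1_def by blast
  then show "E (- u) = E u" by simp
qed (use assms in \<open>auto simp: weak_A1_def\<close>)

lemma weak_A1_diff_vec:
  assumes "E \<in> weak_A1"
  shows "E (u - vec c) = E u"
  using weak_A1D(3)[OF assms, of "u - vec c" c] by simp

lemma weak_A1_pos: "E \<in> weak_A1 \<Longrightarrow> 0 < E u \<longleftrightarrow> \<not> is_const u"
  using weak_A1D(1,5)[of E u] by linarith

lemma continuous_on_weak_A1:
  assumes "E \<in> weak_A1" "continuous_on S f"
  shows "continuous_on S (\<lambda>x. E (f x))"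
proof -
  have "continuous_on UNIV E"
    by (rule convex_on_continuous) (use weak_A1D(2)[OF assms(1)] in auto)
  then show ?thesis using assms(2) by (rule continuous_on_compose2) auto
qed

lemma weak_A1_scale_le:
  assumes "E \<in> weak_A1" "0 \<le> t" "t \<le> 1"
  shows "E (t *\<^sub>R u) \<le> t * E u"
proof -
  have "E ((1 - t) *\<^sub>R 0 + t *\<^sub>R u) \<le> (1 - t) * E 0 + t * E u"
    by (rule convex_onD[OF weak_A1D(2)[OF assms(1)]]) (use assms in auto)
  moreover have "E 0 = 0" by (simp add: weak_A1D(5)[OF assms(1)])
  ultimately show ?thesis by simp
qed

text \<open>On vectors of oscillation \<open>\<eta>\<close> the functional has a positive lower bound by compactness, and
  convexity with \<open>E 0 = 0\<close> propagates the bound linearly to larger oscillations.\<close>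

lemma weak_A1_coercive:
  fixes E :: "real ^ 'n::finite \<Rightarrow> real"
  assumes "E \<in> weak_A1" "0 < \<eta>"
  obtains e where "0 < e" "\<And>u. \<eta> \<le> osc u \<Longrightarrow> e * osc u \<le> E u"
proof -
  define K where "K = {u :: real ^ 'n. vmin u = 0 \<and> \<eta> \<le> osc u \<and> osc u \<le> \<eta>}"
  have "compact K" unfolding K_def by (rule compact_normalized_annulus)
  have cont: "continuous_on K E" using continuous_on_weak_A1[OF assms(1) continuous_on_id] by simp
  obtain e where e: "0 < e" "\<And>u. u \<in> K \<Longrightarrow> e \<le> E u"
  proof (cases "K = {}")
    case True
    then show ?thesis using that[of 1] by simp
  next
    case False
    obtain m where m: "m \<in> K" "\<And>u. u \<in> K \<Longrightarrow> E m \<le> E u"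
      using continuous_attains_inf[OF \<open>compact K\<close> False cont] by blast
    have "0 < E m" using m(1) assms(2) by (auto simp: weak_A1_pos[OF assms(1)] K_def simp flip: osc_pos_iff)
    then show ?thesis using that m(2) by blast
  qed
  show ?thesis
  proof (rule that[of "e / \<eta>"])
    show "0 < e / \<eta>" using e assms by simp
  next
    fix u :: "real ^ 'n" assume u: "\<eta> \<le> osc u"
    define t where "t = \<eta> / osc u"
    have t: "0 < t" "t \<le> 1" using u assms(2) by (auto simp: t_def)
    define w where "w = t *\<^sub>R (u - vec (vmin u))"
    have "osc w = \<eta>" using t u assms(2) by (simp add: w_def osc_scaleR t_def)
    moreover have "vmin w = 0" using t by (simp add: w_def vmin_scaleR vmin_normalized)
    ultimately have "w \<in> K" by (simp add: K_def)
    then have "e \<le> E w" by (rule e)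
    also have "\<dots> \<le> t * E (u - vec (vmin u))"
      unfolding w_def by (rule weak_A1_scale_le[OF assms(1)]) (use t in auto)
    also have "\<dots> = t * E u" by (simp add: weak_A1_diff_vec[OF assms(1)])
    finally show "e / \<eta> * osc u \<le> E u" using u assms(2) by (simp add: t_def field_simps)
  qed
qed

lemma osc_bounded_on_sublevel:
  fixes E :: "real ^ 'n::finite \<Rightarrow> real"
  assumes "E \<in> weak_A1"
  obtains R where "\<And>u. E u \<le> c \<Longrightarrow> osc u \<le> R"
proof -
  obtain e where e: "0 < e" "\<And>u. 1 \<le> osc u \<Longrightarrow> e * osc u \<le> E u"
    using weak_A1_coercive[OF assms, of 1] by auto
  have "osc u \<le> max 1 (c / e)" if "E u \<le> c" for u
  proof (cases "1 \<le> osc u")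
    case True
    then have "e * osc u \<le> c" using e(2)[of u] that by linarith
    then show ?thesis using e(1) by (simp add: field_simps le_max_iff_disj)
  qed auto
  then show ?thesis by (rule that)
qed

lemma continuous_on_shift_invariant_bounds:
  fixes f :: "real ^ 'n::finite \<Rightarrow> real"
  assumes cont: "continuous_on UNIV f" and pos: "\<And>u. 0 < f u"
    and inv: "\<And>u c. f (u + vec c) = f u"
  obtains a b where "0 < a" "a \<le> b" "\<And>u. osc u \<le> R \<Longrightarrow> a \<le> f u" "\<And>u. osc u \<le> R \<Longrightarrow> f u \<le> b"
proof -
  define K where "K = {u :: real ^ 'n. vmin u = 0 \<and> 0 \<le> osc u \<and> osc u \<le> R}"
  have "compact K" unfolding K_def by (rule compact_normalized_annulus)
  have cont: "continuous_on K f" using cont continuous_on_subset by blast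
  have mem: "u - vec (vmin u) \<in> K" if "osc u \<le> R" for u :: "real ^ 'n"
    using that by (simp add: K_def vmin_normalized osc_nonneg)
  have val: "f (u - vec (vmin u)) = f u" for u
    using inv[of "u - vec (vmin u)" "vmin u"] by simp
  show ?thesis
  proof (cases "K = {}")
    case True
    then show ?thesis using that[of 1 1] mem by auto
  next
    case False
    obtain m where m: "m \<in> K" "\<And>u. u \<in> K \<Longrightarrow> f m \<le> f u"
      using continuous_attains_inf[OF \<open>compact K\<close> False cont] by blast
    obtain M where M: "M \<in> K" "\<And>u. u \<in> K \<Longrightarrow> f u \<le> f M"
      using continuous_attains_sup[OF \<open>compact K\<close> False cont] by blast
    show ?thesis
      by (rule that[of "f m" "f M"]) (use pos m M mem val in \<open>metis+\<close>)
  qed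
qed

section \<open>The renormalization operator through compatible matrices\<close>

definition cell_sum :: "(real ^ 'n::finite \<Rightarrow> real) \<Rightarrow> real ^ 'n ^ 'k::finite \<Rightarrow> real" where
  "cell_sum E W = (\<Sum>i\<in>UNIV. E (W $ i))"

lemma bounded_matrix_box:
  "bounded {W :: real ^ 'n::finite ^ 'k::finite. \<forall>i j. a \<le> W $ i $ j \<and> W $ i $ j \<le> b}"
proof -
  have "norm W \<le> (\<Sum>i\<in>(UNIV :: 'k set). \<Sum>j\<in>(UNIV :: 'n set). max \<bar>a\<bar> \<bar>b\<bar>)"
    if "\<forall>i j. a \<le> W $ i $ j \<and> W $ i $ j \<le> b" for W :: "real ^ 'n ^ 'k"
  proof -
    have "norm W \<le> (\<Sum>i\<in>UNIV. norm (W $ i))"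
      by (simp add: norm_vec_def L2_set_le_sum)
    also have "\<dots> \<le> (\<Sum>i\<in>UNIV. \<Sum>j\<in>UNIV. \<bar>W $ i $ j\<bar>)"
      by (intro sum_mono norm_le_l1_cart)
    also have "\<dots> \<le> (\<Sum>i\<in>(UNIV :: 'k set). \<Sum>j\<in>(UNIV :: 'n set). max \<bar>a\<bar> \<bar>b\<bar>)"
    proof (intro sum_mono)
      fix i j
      have "a \<le> W $ i $ j" "W $ i $ j \<le> b" using that by auto
      then show "\<bar>W $ i $ j\<bar> \<le> max \<bar>a\<bar> \<bar>b\<bar>" by linarith
    qed
    finally show ?thesis .
  qed
  then show ?thesis unfolding bounded_iff by blast
qed

context fractal
begin

text \<open>A function \<open>v\<close> on \<open>V\<^sup>(\<^sup>1\<^sup>)\<close> is encoded by the matrix of its values at the points \<open>\<psi> i (P j)\<close>;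
  in this way the functions on \<open>V\<^sup>(\<^sup>1\<^sup>)\<close> with boundary values \<open>u\<close> form a closed convex subset of a
  Euclidean space.\<close>

definition extensions :: "real ^ 'n \<Rightarrow> (real ^ 'n ^ 'k) set" where
  "extensions u = {W. (\<forall>i j i' j'. \<psi> i (P j) = \<psi> i' (P j') \<longrightarrow> W $ i $ j = W $ i' $ j') \<and>
     (\<forall>j. W $ \<iota> j $ j = u $ j)}"

definition cells :: "('a \<Rightarrow> real) \<Rightarrow> real ^ 'n ^ 'k" where
  "cells v = (\<chi> i. restr0 P (v \<circ> \<psi> i))"

definition minimizer :: "(real ^ 'n \<Rightarrow> real) \<Rightarrow> real ^ 'n \<Rightarrow> real ^ 'n ^ 'k \<Rightarrow> bool" where
  "minimizer E u W \<longleftrightarrow> W \<in> extensions u \<and> (\<forall>i j. vmin u \<le> W $ i $ j \<and> W $ i $ j \<le> vmax u) \<and>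
     (\<forall>W'\<in>extensions u. cell_sum E W \<le> cell_sum E W')"

definition renorm :: "(real ^ 'n \<Rightarrow> real) \<Rightarrow> real ^ 'n \<Rightarrow> real" where
  "renorm E u = Lam P \<psi> 1 E u"

lemma extensionsI:
  assumes "\<And>i j i' j'. \<psi> i (P j) = \<psi> i' (P j') \<Longrightarrow> W $ i $ j = W $ i' $ j'"
    "\<And>j. W $ \<iota> j $ j = u $ j"
  shows "W \<in> extensions u"
  using assms unfolding extensions_def mem_Collect_eq by blast

lemma extensionsD:
  assumes "W \<in> extensions u"
  shows "\<psi> i (P j) = \<psi> i' (P j') \<Longrightarrow> W $ i $ j = W $ i' $ j'" "W $ \<iota> j $ j = u $ j"
  using assms unfolding extensions_def mem_Collect_eq by blast+

lemma minimizerD: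
  assumes "minimizer E u W"
  shows "W \<in> extensions u" "vmin u \<le> W $ i $ j" "W $ i $ j \<le> vmax u"
    "W' \<in> extensions u \<Longrightarrow> cell_sum E W \<le> cell_sum E W'"
  using assms unfolding minimizer_def by blast+

lemma cells_nth [simp]: "cells v $ i $ j = v (\<psi> i (P j))"
  by (simp add: cells_def restr0_def)

lemma boundary_point_in_cell: "\<psi> i (P j) = P l \<Longrightarrow> i = \<iota> l \<and> j = l"
proof -
  assume eq: "\<psi> i (P j) = P l"
  then have "P l \<in> \<psi> i ` range P" by (metis rangeI image_eqI)
  then have i: "i = \<iota> l" using P_not_in_cell by blast
  then have "\<psi> (\<iota> l) (P j) = \<psi> (\<iota> l) (P l)" using eq fixed_point by simp
  then show ?thesis using i inj_\<psi> inj_P by (auto dest: injD)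
qed

lemma cells_in_extensions: "cells v \<in> extensions (restr0 P v)"
  by (simp add: extensions_def restr0_def fixed_point)

lemma extensions_eq_cells: "extensions u = cells ` ext_V1 P \<psi> u"
proof (intro equalityI subsetI)
  fix W assume W: "W \<in> extensions u"
  define v where "v x = (if x \<in> V1 P \<psi> then (SOME r. \<exists>i j. x = \<psi> i (P j) \<and> r = W $ i $ j) else undefined)"
    for x
  have v: "v (\<psi> i (P j)) = W $ i $ j" for i j
  proof -
    have compat: "W $ i' $ j' = W $ i $ j" if "\<psi> i (P j) = \<psi> i' (P j')" for i' j'
      using extensionsD(1)[OF W] that by metis
    have "(SOME r. \<exists>i' j'. \<psi> i (P j) = \<psi> i' (P j') \<and> r = W $ i' $ j') = W $ i $ j"
      by (rule some_equality) (use compat in blast)+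
    then show ?thesis by (auto simp: v_def V1_def)
  qed
  have "v (P j) = u $ j" for j
    using v[of "\<iota> j" j] extensionsD(2)[OF W] by (simp add: fixed_point)
  then have "v \<in> ext_V1 P \<psi> u"
    by (auto simp: ext_V1_def restr0_def vec_eq_iff extensional_def v_def)
  moreover have "W = cells v" by (simp add: vec_eq_iff v)
  ultimately show "W \<in> cells ` ext_V1 P \<psi> u" by blast
next
  fix W assume "W \<in> cells ` ext_V1 P \<psi> u"
  then show "W \<in> extensions u" using cells_in_extensions by (auto simp: ext_V1_def)
qed

lemma Lam_eq_INF: "Lam P \<psi> \<theta> E u = (INF W\<in>extensions u. \<Sum>i\<in>UNIV. E (\<theta> *\<^sub>R W $ i))"
  by (simp add: Lam_def S_op_def extensions_eq_cells image_image cells_def)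

lemma extensions_nonempty: "extensions u \<noteq> {}"
proof -
  define v where "v x = u $ (inv P x)" for x
  have "restr0 P v = u" by (simp add: v_def restr0_def vec_eq_iff inj_P)
  then show ?thesis using cells_in_extensions[of v] by auto
qed

lemma closed_extensions_graph: "closed {p. snd p \<in> extensions (fst p)}"
proof -
  have "closed {p :: (real ^ 'n) \<times> (real ^ 'n ^ 'k). (\<forall>i j i' j'. \<psi> i (P j) = \<psi> i' (P j') \<longrightarrow> snd p $ i $ j = snd p $ i' $ j') \<and>
     (\<forall>j. snd p $ \<iota> j $ j = fst p $ j)}"
    by (intro closed_Collect_conj closed_Collect_all closed_Collect_imp closed_Collect_eq
        continuous_intros open_Collect_const)
  then show ?thesis by (simp add: extensions_def)
qed

lemma closed_extensions: "closed (extensions u)"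
proof -
  have "closed ((\<lambda>W. (u, W)) -` {p. snd p \<in> extensions (fst p)})"
    by (intro closed_vimage closed_extensions_graph continuous_intros)
  then show ?thesis by (simp add: vimage_def)
qed

lemma extensions_convex:
  assumes "W \<in> extensions u" "W' \<in> extensions u'"
  shows "a *\<^sub>R W + b *\<^sub>R W' \<in> extensions (a *\<^sub>R u + b *\<^sub>R u')"
proof (rule extensionsI)
  fix i j i' j' assume "\<psi> i (P j) = \<psi> i' (P j')"
  then have "W $ i $ j = W $ i' $ j'" "W' $ i $ j = W' $ i' $ j'"
    using assms extensionsD(1) by blast+
  then show "(a *\<^sub>R W + b *\<^sub>R W') $ i $ j = (a *\<^sub>R W + b *\<^sub>R W') $ i' $ j'" by simp
next
  fix j show "(a *\<^sub>R W + b *\<^sub>R W') $ \<iota> j $ j = (a *\<^sub>R u + b *\<^sub>R u') $ j"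
    using assms by (simp add: extensionsD(2))
qed

lemma extensions_scaleR: "W \<in> extensions u \<Longrightarrow> a *\<^sub>R W \<in> extensions (a *\<^sub>R u)"
  using extensions_convex[of W u W u a 0] by simp

lemma extensions_scaleR_iff: "a \<noteq> 0 \<Longrightarrow> W \<in> extensions (a *\<^sub>R u) \<longleftrightarrow> (1 / a) *\<^sub>R W \<in> extensions u"
  using extensions_scaleR[of W "a *\<^sub>R u" "1 / a"] extensions_scaleR[of "(1 / a) *\<^sub>R W" u a] by auto

lemma extensions_add_vec: "W \<in> extensions u \<Longrightarrow> W + (\<chi> i. vec c) \<in> extensions (u + vec c)"
proof (rule extensionsI)
  fix i j i' j' assume "W \<in> extensions u" "\<psi> i (P j) = \<psi> i' (P j')"
  then have "W $ i $ j = W $ i' $ j'" using extensionsD(1) by blast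
  then show "(W + (\<chi> i. vec c)) $ i $ j = (W + (\<chi> i. vec c)) $ i' $ j'" by simp
qed (simp add: extensionsD(2))

lemma extensions_uminus: "W \<in> extensions u \<Longrightarrow> - W \<in> extensions (- u)"
  using extensions_scaleR[of W u "-1"] by simp

lemma continuous_on_cell_sum:
  assumes "E \<in> weak_A1" "continuous_on S f"
  shows "continuous_on S (\<lambda>x. cell_sum E (f x))"
  unfolding cell_sum_def using assms
  by (intro continuous_intros continuous_on_weak_A1) auto

lemma cell_sum_nonneg: "E \<in> weak_A1 \<Longrightarrow> 0 \<le> cell_sum E W"
  unfolding cell_sum_def by (intro sum_nonneg weak_A1D(1))

lemma cell_sum_add_vec: "E \<in> weak_A1 \<Longrightarrow> cell_sum E (W + (\<chi> i. vec c)) = cell_sum E W"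
  by (simp add: cell_sum_def weak_A1D(3))

lemma cell_sum_uminus: "E \<in> weak_A1 \<Longrightarrow> cell_sum E (- W) = cell_sum E W"
  by (simp add: cell_sum_def weak_A1D(4))

text \<open>Truncating at the extreme boundary values does not increase the energy, so the infimum may be
  taken over a compact set.\<close>

lemma minimizer_exists:
  assumes E: "E \<in> weak_A1"
  shows "\<exists>W. minimizer E u W"
proof -
  define K where "K = extensions u \<inter> {W. \<forall>i j. vmin u \<le> W $ i $ j \<and> W $ i $ j \<le> vmax u}"
  define cl where "cl W = (\<chi> i. clip (vmax u) (vmin u) (W $ i))" for W :: "real ^ 'n ^ 'k"
  have cl: "cl W \<in> K \<and> cell_sum E (cl W) \<le> cell_sum E W" if "W \<in> extensions u" for W
  proof
    have "cl W \<in> extensions u"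
    proof (rule extensionsI)
      fix i j i' j' assume "\<psi> i (P j) = \<psi> i' (P j')"
      then have "W $ i $ j = W $ i' $ j'" using that extensionsD(1) by blast
      then show "cl W $ i $ j = cl W $ i' $ j'" by (simp add: cl_def clip_def)
    next
      fix j show "cl W $ \<iota> j $ j = u $ j"
        using extensionsD(2)[OF that, of j] vmin_le[of u j] vmax_ge[of u j]
        by (simp add: cl_def clip_def)
    qed
    then show "cl W \<in> K"
      using vmin_le_vmax[of u] by (simp add: K_def cl_def clip_def)
    show "cell_sum E (cl W) \<le> cell_sum E W"
      unfolding cell_sum_def cl_def using vmin_le_vmax[of u] weak_A1D(6)[OF E]
      by (intro sum_mono) simp
  qed
  have "closed K" unfolding K_def
    by (intro closed_Int closed_extensions closed_Collect_all closed_Collect_conj closed_Collect_le continuous_intros)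
  moreover have "bounded K"
    by (rule bounded_subset[OF bounded_matrix_box[of "vmin u" "vmax u"]]) (auto simp: K_def)
  ultimately have "compact K" by (simp add: compact_eq_bounded_closed)
  moreover have "K \<noteq> {}" using cl extensions_nonempty[of u] by blast
  moreover have "continuous_on K (cell_sum E)"
    using continuous_on_cell_sum[OF E continuous_on_id] by simp
  ultimately have "\<exists>W\<in>K. \<forall>W'\<in>K. cell_sum E W \<le> cell_sum E W'"
    by (rule continuous_attains_inf)
  then obtain W where W: "W \<in> K" "\<And>W'. W' \<in> K \<Longrightarrow> cell_sum E W \<le> cell_sum E W'"
    by blast
  have "cell_sum E W \<le> cell_sum E W'" if "W' \<in> extensions u" for W'
    using W(2)[of "cl W'"] cl[OF that] by linarith
  then show ?thesis using W(1) unfolding minimizer_def K_def by blast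
qed

lemma renorm_eq:
  assumes "minimizer E u W"
  shows "renorm E u = cell_sum E W"
proof -
  have "(INF W\<in>extensions u. \<Sum>i\<in>UNIV. E (1 *\<^sub>R W $ i)) = (INF W\<in>extensions u. cell_sum E W)"
    by (simp add: cell_sum_def)
  also have "\<dots> = cell_sum E W"
    using minimizerD(1,4)[OF assms] by (intro cInf_eq_minimum) blast+
  finally show ?thesis by (simp add: renorm_def Lam_eq_INF)
qed

lemma renorm_le:
  assumes "E \<in> weak_A1" "W \<in> extensions u"
  shows "renorm E u \<le> cell_sum E W"
  using minimizer_exists[OF assms(1), of u] assms(2) renorm_eq minimizerD(4) by metis

lemma minimizerI:
  assumes "E \<in> weak_A1" "W \<in> extensions u" "\<And>i j. vmin u \<le> W $ i $ j" "\<And>i j. W $ i $ j \<le> vmax u"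
    "cell_sum E W \<le> renorm E u"
  shows "minimizer E u W"
  using assms renorm_le[OF assms(1)] unfolding minimizer_def by fastforce

lemma Lam_eq_renorm:
  assumes "\<theta> \<noteq> 0"
  shows "Lam P \<psi> \<theta> E u = renorm E (\<theta> *\<^sub>R u)"
proof -
  have "extensions (\<theta> *\<^sub>R u) = (\<lambda>W. \<theta> *\<^sub>R W) ` extensions u"
  proof (intro equalityI subsetI)
    fix W assume "W \<in> extensions (\<theta> *\<^sub>R u)"
    then have "(1 / \<theta>) *\<^sub>R W \<in> extensions u" using assms extensions_scaleR_iff by blast
    then show "W \<in> (\<lambda>W. \<theta> *\<^sub>R W) ` extensions u"
      by (rule rev_image_eqI) (use assms in simp)
  qed (auto intro: extensions_scaleR)
  then show ?thesis by (simp add: renorm_def Lam_eq_INF image_image)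
qed

lemma renorm_nonneg: "E \<in> weak_A1 \<Longrightarrow> 0 \<le> renorm E u"
  using minimizer_exists[of E u] cell_sum_nonneg renorm_eq by metis

lemma minimizer_add_vec:
  assumes "E \<in> weak_A1" "minimizer E u W"
  shows "minimizer E (u + vec c) (W + (\<chi> i. vec c))"
proof -
  have "cell_sum E (W + (\<chi> i. vec c)) \<le> cell_sum E W'" if "W' \<in> extensions (u + vec c)" for W'
  proof -
    have eq: "vec c + vec (- c) = (0 :: real ^ 'n)"
      by (simp flip: vec_add)
    have "W' + (\<chi> i. vec (- c)) \<in> extensions u"
      using extensions_add_vec[OF that, of "- c"] by (simp add: add.assoc eq)
    then have "cell_sum E W \<le> cell_sum E (W' + (\<chi> i. vec (- c)))"
      using minimizerD(4)[OF assms(2)] by blast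
    then show ?thesis using assms(1) by (simp only: cell_sum_add_vec)
  qed
  then show ?thesis
    using minimizerD(2,3)[OF assms(2)] extensions_add_vec[OF minimizerD(1)[OF assms(2)], of c]
    unfolding minimizer_def by (simp add: vmin_add_vec vmax_add_vec)
qed

lemma minimizer_uminus:
  assumes "E \<in> weak_A1" "minimizer E u W"
  shows "minimizer E (- u) (- W)"
proof -
  have "cell_sum E (- W) \<le> cell_sum E W'" if "W' \<in> extensions (- u)" for W'
  proof -
    have "- W' \<in> extensions u" using extensions_uminus[OF that] by simp
    then have "cell_sum E W \<le> cell_sum E (- W')"
      using minimizerD(4)[OF assms(2)] by blast
    then show ?thesis using assms(1) by (simp only: cell_sum_uminus)
  qed
  then show ?thesis
    using minimizerD(2,3)[OF assms(2)] extensions_uminus[OF minimizerD(1)[OF assms(2)]]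
    unfolding minimizer_def by (simp add: vmin_uminus vmax_uminus)
qed

lemma renorm_add_vec: "E \<in> weak_A1 \<Longrightarrow> renorm E (u + vec c) = renorm E u"
  using minimizer_exists[of E u] minimizer_add_vec renorm_eq cell_sum_add_vec by metis

lemma convex_renorm:
  assumes E: "E \<in> weak_A1"
  shows "convex_on UNIV (renorm E)"
proof (rule convex_onI)
  fix t :: real and x y :: "real ^ 'n"
  assume t: "0 < t" "t < 1"
  obtain Wx Wy where W: "minimizer E x Wx" "minimizer E y Wy" using minimizer_exists[OF E] by metis
  have "renorm E ((1 - t) *\<^sub>R x + t *\<^sub>R y) \<le> cell_sum E ((1 - t) *\<^sub>R Wx + t *\<^sub>R Wy)"
    using W minimizerD(1) by (intro renorm_le[OF E] extensions_convex) blast+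
  also have "\<dots> \<le> (\<Sum>i\<in>UNIV. (1 - t) * E (Wx $ i) + t * E (Wy $ i))"
    unfolding cell_sum_def vector_add_component vector_scaleR_component
    by (intro sum_mono convex_onD[OF weak_A1D(2)[OF E]]) (use t in auto)
  also have "\<dots> = (1 - t) * renorm E x + t * renorm E y"
    using W by (simp add: renorm_eq cell_sum_def sum.distrib sum_distrib_left)
  finally show "renorm E ((1 - t) *\<^sub>R x + t *\<^sub>R y) \<le> (1 - t) * renorm E x + t * renorm E y" .
qed auto

lemma continuous_on_renorm:
  assumes "E \<in> weak_A1" "continuous_on S f"
  shows "continuous_on S (\<lambda>x. renorm E (f x))"
proof -
  have "continuous_on UNIV (renorm E)"
    by (rule convex_on_continuous[OF open_UNIV convex_renorm[OF assms(1)]])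
  then show ?thesis using assms(2) by (rule continuous_on_compose2) auto
qed

text \<open>A function on \<open>V\<^sup>(\<^sup>1\<^sup>)\<close> that is constant on every cell is constant, because \<open>V\<^sup>(\<^sup>1\<^sup>)\<close> is connected.\<close>

lemma renorm_pos:
  assumes E: "E \<in> weak_A1" and u: "\<not> is_const u"
  shows "0 < renorm E u"
proof (rule ccontr)
  assume "\<not> 0 < renorm E u"
  then have 0: "renorm E u = 0" using renorm_nonneg[OF E, of u] by simp
  obtain W where W: "minimizer E u W" using minimizer_exists[OF E] by blast
  then have "cell_sum E W = 0" using 0 renorm_eq by simp
  then have "\<forall>i\<in>UNIV. E (W $ i) = 0"
    unfolding cell_sum_def by (subst (asm) sum_nonneg_eq_0_iff) (auto intro: weak_A1D(1)[OF E])
  then have "\<forall>i. is_const (W $ i)" by (simp add: weak_A1D(5)[OF E])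
  then obtain c where c: "\<And>i. W $ i = vec (c i)" unfolding is_const_def by metis
  have "c i = c i'" for i i'
    using V1_connected[of i i']
  proof (induction rule: rtrancl_induct)
    case (step l l')
    then obtain j j' where "\<psi> l (P j) = \<psi> l' (P j')" by blast
    then have "W $ l $ j = W $ l' $ j'" using minimizerD(1)[OF W] extensionsD(1) by blast
    then show ?case using step.IH by (simp add: c)
  qed simp
  then obtain d where "\<And>i. c i = d" by metis
  then have "u = vec d"
    using c extensionsD(2)[OF minimizerD(1)[OF W]] by (auto simp: vec_eq_iff)
  then show False using u by simp
qed

lemma renorm_const:
  assumes E: "E \<in> weak_A1" and u: "is_const u"
  shows "renorm E u = 0"
proof -
  obtain W where W: "minimizer E u W" using minimizer_exists[OF E] by blast
  obtain c where c: "u = vec c" using u is_const_def by blast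
  have "W $ i = vec c" for i
    using minimizerD(2,3)[OF W] by (simp add: c vec_eq_iff order_antisym)
  then show ?thesis using renorm_eq[OF W] by (simp add: cell_sum_def weak_A1D(5)[OF E])
qed

text \<open>Along the ray through a nonconstant vector the renormalized energy is convex, vanishes at \<open>0\<close> and
  is positive elsewhere.\<close>

lemma renorm_scaleR_less:
  assumes E: "E \<in> weak_A1" and u: "\<not> is_const u" and st: "0 \<le> s" "s < t"
  shows "renorm E (s *\<^sub>R u) < renorm E (t *\<^sub>R u)"
proof -
  have "renorm E ((1 - s / t) *\<^sub>R 0 + (s / t) *\<^sub>R (t *\<^sub>R u)) \<le> (1 - s / t) * renorm E 0 + s / t * renorm E (t *\<^sub>R u)"
    by (rule convex_onD[OF convex_renorm[OF E]]) (use st in auto)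
  then have "renorm E (s *\<^sub>R u) \<le> s / t * renorm E (t *\<^sub>R u)" using st by (simp add: renorm_const[OF E])
  moreover have "0 < renorm E (t *\<^sub>R u)" using renorm_pos[OF E] st u by simp
  moreover have "s / t < 1" using st by simp
  ultimately show ?thesis by (smt (verit) mult_less_cancel_right2)
qed

lemma renorm_scale_le:
  assumes E: "E \<in> weak_A1" and t: "1 \<le> t"
  shows "t * renorm E u \<le> renorm E (t *\<^sub>R u)"
proof -
  have "renorm E ((1 - 1 / t) *\<^sub>R 0 + (1 / t) *\<^sub>R (t *\<^sub>R u)) \<le> (1 - 1 / t) * renorm E 0 + 1 / t * renorm E (t *\<^sub>R u)"
    by (rule convex_onD[OF convex_renorm[OF E]]) (use t in auto)
  then show ?thesis using t by (simp add: renorm_const[OF E] field_simps)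
qed

end

section \<open>The scaling factor\<close>

context fractal
begin

lemma scaling_ex1:
  assumes E: "E \<in> weak_A1" and u: "\<not> is_const u" and s: "0 < s"
  shows "\<exists>!\<theta>. 0 < \<theta> \<and> Lam P \<psi> \<theta> E u = s"
proof -
  define T where "T = max 1 (s / renorm E u)"
  have pos: "0 < renorm E u" by (rule renorm_pos[OF E u])
  have "s \<le> T * renorm E u" using pos by (simp add: T_def max_def field_simps)
  also have "\<dots> \<le> renorm E (T *\<^sub>R u)" by (rule renorm_scale_le[OF E]) (simp add: T_def)
  finally have "s \<le> renorm E (T *\<^sub>R u)" .
  moreover have "renorm E (0 *\<^sub>R u) \<le> s" using s by (simp add: renorm_const[OF E])
  moreover have "continuous_on {0..T} (\<lambda>t. renorm E (t *\<^sub>R u))"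
    by (intro continuous_on_renorm[OF E] continuous_intros)
  ultimately obtain t where t: "0 \<le> t" "renorm E (t *\<^sub>R u) = s"
    using IVT'[of "\<lambda>t. renorm E (t *\<^sub>R u)" 0 s T] T_def by fastforce
  have "t \<noteq> 0"
  proof
    assume "t = 0"
    then show False using t s by (simp add: renorm_const[OF E])
  qed
  then have "0 < t \<and> Lam P \<psi> t E u = s" using t by (simp add: Lam_eq_renorm)
  moreover have "t' = t" if "0 < t' \<and> Lam P \<psi> t' E u = s" for t'
  proof (rule ccontr)
    assume "t' \<noteq> t"
    then consider "t < t'" | "t' < t" by linarith
    then show False
      using renorm_scaleR_less[OF E u, of t t'] renorm_scaleR_less[OF E u, of t' t] that t
      by cases (auto simp: Lam_eq_renorm)
  qed
  ultimately show ?thesis by blast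
qed

lemma theta_bar_nonconst:
  assumes E: "E \<in> weak_A1" and u: "\<not> is_const u" and s: "0 < \<sigma>"
  shows "0 < theta_bar P \<psi> \<sigma> E u" "renorm E (theta_bar P \<psi> \<sigma> E u *\<^sub>R u) = \<sigma> * E u"
proof -
  have "0 < \<sigma> * E u" using s u by (simp add: weak_A1_pos[OF E])
  from theI'[OF scaling_ex1[OF E u this]]
  have *: "0 < theta_bar P \<psi> \<sigma> E u \<and> Lam P \<psi> (theta_bar P \<psi> \<sigma> E u) E u = \<sigma> * E u"
    using u by (simp add: theta_bar_def)
  then show pos: "0 < theta_bar P \<psi> \<sigma> E u" by blast
  from * have "Lam P \<psi> (theta_bar P \<psi> \<sigma> E u) E u = \<sigma> * E u" by blast
  then show "renorm E (theta_bar P \<psi> \<sigma> E u *\<^sub>R u) = \<sigma> * E u"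
    using Lam_eq_renorm[of "theta_bar P \<psi> \<sigma> E u" E u] pos by linarith
qed

lemma theta_bar_unique:
  assumes E: "E \<in> weak_A1" and u: "\<not> is_const u" and s: "0 < \<sigma>"
    and t: "0 < t" "renorm E (t *\<^sub>R u) = \<sigma> * E u"
  shows "t = theta_bar P \<psi> \<sigma> E u"
proof -
  have "0 < \<sigma> * E u" using s u by (simp add: weak_A1_pos[OF E])
  note ex1 = scaling_ex1[OF E u this]
  show ?thesis
  proof (rule trans[OF the1_equality[OF ex1, symmetric] the1_equality[OF ex1]])
    show "0 < t \<and> Lam P \<psi> t E u = \<sigma> * E u"
      using t Lam_eq_renorm[of t E u] by linarith
    show "0 < theta_bar P \<psi> \<sigma> E u \<and> Lam P \<psi> (theta_bar P \<psi> \<sigma> E u) E u = \<sigma> * E u"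
      using theta_bar_nonconst[OF E u s] Lam_eq_renorm[of "theta_bar P \<psi> \<sigma> E u" E u] by linarith
  qed
qed

lemma less_theta_bar:
  assumes E: "E \<in> weak_A1" and u: "\<not> is_const u" and s: "0 < \<sigma>"
    and "renorm E (a *\<^sub>R u) < \<sigma> * E u"
  shows "a < theta_bar P \<psi> \<sigma> E u"
proof (rule ccontr)
  assume "\<not> a < theta_bar P \<psi> \<sigma> E u"
  then have "theta_bar P \<psi> \<sigma> E u < a \<or> theta_bar P \<psi> \<sigma> E u = a" by auto
  then show False
    using theta_bar_nonconst[OF E u s] assms(4)
      renorm_scaleR_less[OF E u, of "theta_bar P \<psi> \<sigma> E u" a] by auto
qed

lemma theta_bar_less:
  assumes E: "E \<in> weak_A1" and u: "\<not> is_const u" and s: "0 < \<sigma>"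
    and "0 \<le> a" "\<sigma> * E u < renorm E (a *\<^sub>R u)"
  shows "theta_bar P \<psi> \<sigma> E u < a"
proof (rule ccontr)
  assume "\<not> theta_bar P \<psi> \<sigma> E u < a"
  then have "a < theta_bar P \<psi> \<sigma> E u \<or> theta_bar P \<psi> \<sigma> E u = a" by auto
  then show False
    using theta_bar_nonconst[OF E u s] assms(4,5)
      renorm_scaleR_less[OF E u, of a "theta_bar P \<psi> \<sigma> E u"] by auto
qed

lemma theta_bar_add_vec:
  assumes E: "E \<in> weak_A1"
  shows "theta_bar P \<psi> \<sigma> E (u + vec c) = theta_bar P \<psi> \<sigma> E u"
proof -
  have const: "is_const (u + vec c) = is_const u" by (simp add: is_const_iff_osc)
  have Lam_eq: "Lam P \<psi> t E (u + vec c) = Lam P \<psi> t E u" if "0 < t" for t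
  proof -
    have "t *\<^sub>R (u + vec c) = t *\<^sub>R u + vec (t * c)" by (simp add: vec_eq_iff distrib_left)
    then show ?thesis using that by (simp add: Lam_eq_renorm renorm_add_vec[OF E])
  qed
  from Lam_eq have "(\<lambda>t. 0 < t \<and> Lam P \<psi> t E (u + vec c) = \<sigma> * E u) = (\<lambda>t. 0 < t \<and> Lam P \<psi> t E u = \<sigma> * E u)"
    by auto
  with const show ?thesis
    unfolding theta_bar_def weak_A1D(3)[OF E] by simp
qed

lemma A2_witnessD:
  assumes "A2_witness P \<psi> E Et p \<rho>"
  shows "Et \<in> weak_A1" "0 < p" "Et (t *\<^sub>R u) = \<bar>t\<bar> powr p * Et u" "0 < \<rho>" "renorm Et u = \<rho> * Et u"
    "((\<lambda>u. E u / Et u) \<longlongrightarrow> 1) (at 0 within {u. \<not> is_const u})"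
  using assms unfolding A2_witness_def renorm_def by simp_all

text \<open>The limit of \<open>E / Et\<close> at \<open>0\<close> controls all vectors of small oscillation, since both functionals are
  invariant under the addition of constants.\<close>

lemma witness_near_const:
  assumes E: "E \<in> weak_A1" and w: "A2_witness P \<psi> E Et p \<rho>" and e: "0 < \<epsilon>"
  obtains \<delta> where "0 < \<delta>" "\<And>u. osc u < \<delta> \<Longrightarrow> (1 - \<epsilon>) * Et u \<le> E u"
    "\<And>u. osc u < \<delta> \<Longrightarrow> E u \<le> (1 + \<epsilon>) * Et u"
proof -
  note Et = A2_witnessD(1)[OF w]
  obtain d where d: "0 < d" "\<And>u. \<not> is_const u \<Longrightarrow> norm u < d \<Longrightarrow> \<bar>E u / Et u - 1\<bar> < \<epsilon>"
    using A2_witnessD(6)[OF w] e unfolding Lim_within by (force simp: dist_norm)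
  define \<delta> where "\<delta> = d / real CARD('n)"
  have n: "0 < real CARD('n)" by simp
  have near: "(1 - \<epsilon>) * Et u \<le> E u \<and> E u \<le> (1 + \<epsilon>) * Et u" if "osc u < \<delta>" for u
  proof (cases "is_const u")
    case True
    then have "E u = 0" "Et u = 0" using weak_A1D(5)[OF E] weak_A1D(5)[OF Et] by auto
    then show ?thesis by simp
  next
    case False
    define v where "v = u - vec (vmin u)"
    have "norm v \<le> real CARD('n) * osc v" by (rule norm_le_osc) (simp add: v_def vmin_normalized)
    also have "\<dots> < d" using that n by (simp add: v_def \<delta>_def field_simps)
    finally have "norm v < d" .
    moreover have "\<not> is_const v" using False by (simp add: v_def is_const_iff_osc)
    ultimately have "\<bar>E v / Et v - 1\<bar> < \<epsilon>" using d by blast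
    moreover have "E v = E u" "Et v = Et u"
      by (simp_all add: v_def weak_A1_diff_vec[OF E] weak_A1_diff_vec[OF Et])
    moreover have "0 < Et u" using False by (simp add: weak_A1_pos[OF Et])
    ultimately show ?thesis by (simp add: abs_less_iff field_simps)
  qed
  show ?thesis by (rule that[of \<delta>]) (use near d(1) n in \<open>auto simp: \<delta>_def\<close>)
qed

lemma minimizer_osc_le: "minimizer E u W \<Longrightarrow> osc (W $ i) \<le> osc u"
  unfolding osc_def[of u] by (intro osc_le_bound minimizerD)

text \<open>Minimizers stay within the range of their boundary values. Hence the comparison of \<open>E\<close> with
  \<open>Et\<close> on vectors of small oscillation passes to the renormalized functionals.\<close>

lemma witness_renorm_near_const:
  assumes E: "E \<in> weak_A1" and w: "A2_witness P \<psi> E Et p \<rho>" and e: "0 \<le> c"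
    and lower: "\<And>u. osc u < \<delta> \<Longrightarrow> c * Et u \<le> E u"
    and upper: "\<And>u. osc u < \<delta> \<Longrightarrow> E u \<le> C * Et u" and u: "osc u < \<delta>"
  shows "c * (\<rho> * Et u) \<le> renorm E u" "renorm E u \<le> C * (\<rho> * Et u)"
proof -
  note Et = A2_witnessD(1)[OF w]
  obtain W where W: "minimizer E u W" using minimizer_exists[OF E] by blast
  have "c * (\<rho> * Et u) = c * renorm Et u" by (simp add: A2_witnessD(5)[OF w])
  also have "\<dots> \<le> c * cell_sum Et W"
    using e by (intro mult_left_mono renorm_le[OF Et minimizerD(1)[OF W]])
  also have "\<dots> \<le> cell_sum E W"
    unfolding cell_sum_def sum_distrib_left
    by (intro sum_mono lower le_less_trans[OF minimizer_osc_le[OF W] u])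
  finally show "c * (\<rho> * Et u) \<le> renorm E u" using renorm_eq[OF W] by simp
  obtain W where W: "minimizer Et u W" using minimizer_exists[OF Et] by blast
  have "renorm E u \<le> cell_sum E W" by (rule renorm_le[OF E minimizerD(1)[OF W]])
  also have "\<dots> \<le> C * cell_sum Et W"
    unfolding cell_sum_def sum_distrib_left
    by (intro sum_mono upper le_less_trans[OF minimizer_osc_le[OF W] u])
  also have "\<dots> = C * (\<rho> * Et u)" using renorm_eq[OF W] by (simp add: A2_witnessD(5)[OF w])
  finally show "renorm E u \<le> C * (\<rho> * Et u)" .
qed

lemma less_powr_iff:
  fixes a x p :: real
  assumes "0 < p" "0 < a" "0 < x"
  shows "a < x powr (1 / p) \<longleftrightarrow> a powr p < x" "x powr (1 / p) < a \<longleftrightarrow> x < a powr p"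
proof -
  have "(x powr (1 / p)) powr p = x" using assms by (simp add: powr_powr)
  then show "a < x powr (1 / p) \<longleftrightarrow> a powr p < x" "x powr (1 / p) < a \<longleftrightarrow> x < a powr p"
    using assms by (metis less_imp_le powr_ge_zero powr_less_mono2 powr_mono2 linorder_not_less)+
qed

text \<open>For \<open>u\<close> of small oscillation \<open>renorm E (a u)\<close> is close to \<open>\<rho> a powr p Et u\<close> and \<open>\<sigma> E u\<close> is close to
  \<open>\<sigma> Et u\<close>; so \<open>a\<close> lies below or above the root according to the sign of \<open>\<rho> a powr p - \<sigma>\<close>.\<close>

lemma theta_bar_near_const:
  assumes E: "E \<in> weak_A1" and w: "A2_witness P \<psi> E Et p \<rho>" and s: "0 < \<sigma>"
  shows "0 < a \<Longrightarrow> a < (\<sigma> / \<rho>) powr (1 / p) \<Longrightarrow>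
      \<exists>\<delta>>0. \<forall>u. \<not> is_const u \<longrightarrow> osc u < \<delta> \<longrightarrow> a < theta_bar P \<psi> \<sigma> E u"
    and "(\<sigma> / \<rho>) powr (1 / p) < b \<Longrightarrow>
      \<exists>\<delta>>0. \<forall>u. \<not> is_const u \<longrightarrow> osc u < \<delta> \<longrightarrow> theta_bar P \<psi> \<sigma> E u < b"
proof -
  note Et = A2_witnessD(1)[OF w] and p = A2_witnessD(2)[OF w] and r = A2_witnessD(4)[OF w]
  {
    assume a: "0 < a" "a < (\<sigma> / \<rho>) powr (1 / p)"
    define x where "x = \<rho> * a powr p"
    have x: "0 < x" "x < \<sigma>"
      using a s r p by (auto simp: x_def less_powr_iff field_simps)
    \<comment> \<open>half of the largest relative error for which \<open>(1 + \<epsilon>) x\<close> stays below \<open>(1 - \<epsilon>) \<sigma>\<close>\<close>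
    define \<epsilon> where "\<epsilon> = (\<sigma> - x) / (2 * (\<sigma> + x))"
    have eps: "0 < \<epsilon>" using x by (simp add: \<epsilon>_def)
    have "\<epsilon> * (\<sigma> + x) = (\<sigma> - x) / 2" using x by (simp add: \<epsilon>_def field_simps)
    then have ineq: "(1 + \<epsilon>) * x < \<sigma> * (1 - \<epsilon>)" using x by (simp add: algebra_simps)
    have eps1: "\<epsilon> \<le> 1" using x by (simp add: \<epsilon>_def field_simps)
    obtain \<delta> where \<delta>: "0 < \<delta>" "\<And>u. osc u < \<delta> \<Longrightarrow> (1 - \<epsilon>) * Et u \<le> E u"
      "\<And>u. osc u < \<delta> \<Longrightarrow> E u \<le> (1 + \<epsilon>) * Et u"
      using witness_near_const[OF E w eps] by blast
    have "a < theta_bar P \<psi> \<sigma> E u" if u: "\<not> is_const u" "osc u < min \<delta> (\<delta> / a)" for u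
    proof (rule less_theta_bar[OF E u(1) s])
      have "osc (a *\<^sub>R u) < \<delta>" using u(2) a by (simp add: osc_scaleR field_simps)
      then have "renorm E (a *\<^sub>R u) \<le> (1 + \<epsilon>) * (\<rho> * Et (a *\<^sub>R u))"
        by (intro witness_renorm_near_const(2)[OF E w _ \<delta>(2,3)]) (use eps1 in auto)
      also have "\<dots> = (1 + \<epsilon>) * x * Et u"
        using a by (simp add: A2_witnessD(3)[OF w] x_def)
      also have "\<dots> < \<sigma> * (1 - \<epsilon>) * Et u"
        using ineq u(1) by (intro mult_strict_right_mono) (auto simp: weak_A1_pos[OF Et])
      also have "\<dots> \<le> \<sigma> * E u" using \<delta>(2)[of u] u(2) s by (simp add: mult.assoc)
      finally show "renorm E (a *\<^sub>R u) < \<sigma> * E u" .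
    qed
    then show "\<exists>\<delta>>0. \<forall>u. \<not> is_const u \<longrightarrow> osc u < \<delta> \<longrightarrow> a < theta_bar P \<psi> \<sigma> E u"
      using \<delta>(1) a by (intro exI[of _ "min \<delta> (\<delta> / a)"]) auto
  next
    assume b: "(\<sigma> / \<rho>) powr (1 / p) < b"
    have b0: "0 < b" using b powr_ge_zero le_less_trans by blast
    define x where "x = \<rho> * b powr p"
    have x: "0 < x" "\<sigma> < x"
      using b0 b s r p by (auto simp: x_def less_powr_iff field_simps)
    define \<epsilon> where "\<epsilon> = (x - \<sigma>) / (2 * (\<sigma> + x))"
    have eps: "0 < \<epsilon>" using x s by (simp add: \<epsilon>_def)
    have "\<epsilon> * (\<sigma> + x) = (x - \<sigma>) / 2" using x s by (simp add: \<epsilon>_def field_simps)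
    then have ineq: "\<sigma> * (1 + \<epsilon>) < (1 - \<epsilon>) * x" using x by (simp add: algebra_simps)
    have eps1: "\<epsilon> \<le> 1" using x s by (simp add: \<epsilon>_def field_simps)
    obtain \<delta> where \<delta>: "0 < \<delta>" "\<And>u. osc u < \<delta> \<Longrightarrow> (1 - \<epsilon>) * Et u \<le> E u"
      "\<And>u. osc u < \<delta> \<Longrightarrow> E u \<le> (1 + \<epsilon>) * Et u"
      using witness_near_const[OF E w eps] by blast
    have "theta_bar P \<psi> \<sigma> E u < b" if u: "\<not> is_const u" "osc u < min \<delta> (\<delta> / b)" for u
    proof (rule theta_bar_less[OF E u(1) s])
      have "\<sigma> * E u \<le> \<sigma> * (1 + \<epsilon>) * Et u" using \<delta>(3)[of u] u(2) s by (simp add: mult.assoc)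
      also have "\<dots> < (1 - \<epsilon>) * x * Et u"
        using ineq u(1) by (intro mult_strict_right_mono) (auto simp: weak_A1_pos[OF Et])
      also have "\<dots> = (1 - \<epsilon>) * (\<rho> * Et (b *\<^sub>R u))"
        using b0 by (simp add: A2_witnessD(3)[OF w] x_def)
      also have "\<dots> \<le> renorm E (b *\<^sub>R u)"
        using u(2) b0 eps1
        by (intro witness_renorm_near_const(1)[OF E w _ \<delta>(2,3)]) (auto simp: osc_scaleR field_simps)
      finally show "\<sigma> * E u < renorm E (b *\<^sub>R u)" .
    qed (use b0 in simp)
    then show "\<exists>\<delta>>0. \<forall>u. \<not> is_const u \<longrightarrow> osc u < \<delta> \<longrightarrow> theta_bar P \<psi> \<sigma> E u < b"
      using \<delta>(1) b0 by (intro exI[of _ "min \<delta> (\<delta> / b)"]) auto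
  }
qed

lemma nonconst_exists:
  assumes "0 < \<delta>"
  shows "\<exists>u :: real ^ 'n. \<not> is_const u \<and> osc u < \<delta>"
proof -
  obtain a b :: 'n where "a \<noteq> b"
    using card_ge_2 card_le_Suc0_iff_eq[of "UNIV :: 'n set"] by force
  define u :: "real ^ 'n" where "u = axis a 1"
  have "u $ a \<noteq> u $ b" using \<open>a \<noteq> b\<close> by (simp add: u_def axis_def)
  then have u: "\<not> is_const u" by (auto simp: is_const_def)
  then have pos: "0 < osc u" by (simp add: osc_pos_iff)
  define t where "t = \<delta> / (2 * osc u)"
  have "osc (t *\<^sub>R u) < \<delta>" "\<not> is_const (t *\<^sub>R u)"
    using pos assms u by (auto simp: t_def osc_scaleR)
  then show ?thesis by blast
qed

text \<open>Near the constants the scaling factor approaches \<open>(\<sigma> / \<rho>) powr (1 / p)\<close>, whichever witness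
  is used; hence this number is the same for all witnesses.\<close>

lemma theta_bar_const:
  assumes E: "E \<in> weak_A1" and w: "A2_witness P \<psi> E Et p \<rho>" and s: "0 < \<sigma>" and u: "is_const u"
  shows "theta_bar P \<psi> \<sigma> E u = (\<sigma> / \<rho>) powr (1 / p)"
proof -
  have le: "(\<sigma> / \<rho>1) powr (1 / p1) \<le> (\<sigma> / \<rho>2) powr (1 / p2)"
    if w1: "A2_witness P \<psi> E E1 p1 \<rho>1" and w2: "A2_witness P \<psi> E E2 p2 \<rho>2" for E1 E2 p1 p2 \<rho>1 \<rho>2
  proof (rule ccontr)
    assume "\<not> ?thesis"
    then obtain m where m: "(\<sigma> / \<rho>2) powr (1 / p2) < m" "m < (\<sigma> / \<rho>1) powr (1 / p1)"
      using dense[of "(\<sigma> / \<rho>2) powr (1 / p2)" "(\<sigma> / \<rho>1) powr (1 / p1)"] by auto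
    have "0 < m" using m(1) powr_ge_zero le_less_trans by blast
    obtain d1 d2 where d: "0 < d1" "0 < d2"
      "\<And>u. \<not> is_const u \<Longrightarrow> osc u < d1 \<Longrightarrow> m < theta_bar P \<psi> \<sigma> E u"
      "\<And>u. \<not> is_const u \<Longrightarrow> osc u < d2 \<Longrightarrow> theta_bar P \<psi> \<sigma> E u < m"
      using theta_bar_near_const(1)[OF E w1 s \<open>0 < m\<close> m(2)] theta_bar_near_const(2)[OF E w2 s m(1)]
      by blast
    obtain u :: "real ^ 'n" where "\<not> is_const u" "osc u < min d1 d2"
      using nonconst_exists[of "min d1 d2"] d(1,2) by auto
    then show False using d(3)[of u] d(4)[of u] by simp
  qed
  have "(THE \<theta>. \<exists>Et p \<rho>. A2_witness P \<psi> E Et p \<rho> \<and> \<theta> = (\<sigma> / \<rho>) powr (1 / p)) = (\<sigma> / \<rho>) powr (1 / p)"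
    by (rule the_equality) (use w le in \<open>blast intro: order_antisym\<close>)+
  then show ?thesis using u by (simp add: theta_bar_def)
qed

lemma theta_bar_pos:
  assumes E: "E \<in> weak_A1" and w: "A2_witness P \<psi> E Et p \<rho>" and s: "0 < \<sigma>"
  shows "0 < theta_bar P \<psi> \<sigma> E u"
  using theta_bar_nonconst[OF E _ s] theta_bar_const[OF E w s] A2_witnessD(4)[OF w] s
  by (cases "is_const u") auto

lemma renorm_theta_bar:
  assumes E: "E \<in> weak_A1" and s: "0 < \<sigma>"
  shows "renorm E (theta_bar P \<psi> \<sigma> E u *\<^sub>R u) = \<sigma> * E u"
  using theta_bar_nonconst[OF E _ s]
  by (cases "is_const u") (auto simp: renorm_const[OF E] weak_A1D(5)[OF E])

text \<open>At nonconstant vectors the factor is the root of an equation between continuous functions, one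
  side of which is strictly increasing in the unknown. So \<open>a\<close> is below the root exactly if a strict
  inequality holds, and the inequality persists near the given vector. At the constants the
  estimates for vectors of small oscillation take the place of the equation.\<close>

lemma continuous_theta_bar:
  assumes E: "E \<in> weak_A1" and w: "A2_witness P \<psi> E Et p \<rho>" and s: "0 < \<sigma>"
  shows "continuous_on UNIV (theta_bar P \<psi> \<sigma> E)"
proof -
  have osc_lim: "(osc \<longlongrightarrow> osc u0) (at u0)" for u0 :: "real ^ 'n"
    using continuous_on_osc[OF continuous_on_id, of "UNIV :: (real ^ 'n) set"] by (simp add: continuous_on_def)
  have renorm_lim: "((\<lambda>u. renorm E (a *\<^sub>R u) - \<sigma> * E u) \<longlongrightarrow> renorm E (a *\<^sub>R u0) - \<sigma> * E u0) (at u0)" for a u0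
  proof -
    have "continuous_on UNIV (\<lambda>u. renorm E (a *\<^sub>R u) - \<sigma> * E u)"
      by (intro continuous_intros continuous_on_renorm[OF E] continuous_on_weak_A1[OF E])
    then show ?thesis by (simp add: continuous_on_def)
  qed
  have "(theta_bar P \<psi> \<sigma> E \<longlongrightarrow> theta_bar P \<psi> \<sigma> E u0) (at u0)" for u0
  proof (cases "is_const u0")
    case True
    have near: "\<forall>\<^sub>F u in at u0. osc u < \<delta>" if "0 < \<delta>" for \<delta>
      by (rule order_tendstoD(2)[OF osc_lim]) (use True that in \<open>simp add: is_const_iff_osc\<close>)
    show ?thesis
    proof (rule order_tendstoI)
      fix a assume a: "a < theta_bar P \<psi> \<sigma> E u0"
      show "\<forall>\<^sub>F u in at u0. a < theta_bar P \<psi> \<sigma> E u"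
      proof (cases "0 < a")
        case False
        then show ?thesis using theta_bar_pos[OF E w s] by (intro always_eventually allI) (metis linorder_not_less order_le_less_trans)
      next
        case a0: True
        obtain \<delta> where \<delta>: "0 < \<delta>" "\<And>u. \<not> is_const u \<Longrightarrow> osc u < \<delta> \<Longrightarrow> a < theta_bar P \<psi> \<sigma> E u"
          using theta_bar_near_const(1)[OF E w s a0] a theta_bar_const[OF E w s True] by auto
        show ?thesis using near[OF \<delta>(1)]
        proof eventually_elim
          case (elim u)
          then show ?case using \<delta>(2)[of u] a theta_bar_const[OF E w s] True by (cases "is_const u") auto
        qed
      qed
    next
      fix a assume a: "theta_bar P \<psi> \<sigma> E u0 < a"
      obtain \<delta> where \<delta>: "0 < \<delta>" "\<And>u. \<not> is_const u \<Longrightarrow> osc u < \<delta> \<Longrightarrow> theta_bar P \<psi> \<sigma> E u < a"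
        using theta_bar_near_const(2)[OF E w s] a theta_bar_const[OF E w s True] by auto
      show "\<forall>\<^sub>F u in at u0. theta_bar P \<psi> \<sigma> E u < a" using near[OF \<delta>(1)]
      proof eventually_elim
        case (elim u)
        then show ?case using \<delta>(2)[of u] a theta_bar_const[OF E w s] True by (cases "is_const u") auto
      qed
    qed
  next
    case False
    note th = theta_bar_nonconst[OF E False s]
    have nc: "\<forall>\<^sub>F u in at u0. \<not> is_const u"
      using order_tendstoD(1)[OF osc_lim, of 0 u0] False by (simp add: osc_pos_iff)
    show ?thesis
    proof (rule order_tendstoI)
      fix a assume a: "a < theta_bar P \<psi> \<sigma> E u0"
      show "\<forall>\<^sub>F u in at u0. a < theta_bar P \<psi> \<sigma> E u"
      proof (cases "0 < a")
        case False
        then show ?thesis using theta_bar_pos[OF E w s] by (intro always_eventually allI) (metis linorder_not_less order_le_less_trans)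
      next
        case a0: True
        have "renorm E (a *\<^sub>R u0) - \<sigma> * E u0 < 0"
          using renorm_scaleR_less[OF E False _ a] a0 th by simp
        from order_tendstoD(2)[OF renorm_lim this] nc show ?thesis
          by eventually_elim (rule less_theta_bar[OF E _ s], auto)
      qed
    next
      fix a assume a: "theta_bar P \<psi> \<sigma> E u0 < a"
      have "0 < renorm E (a *\<^sub>R u0) - \<sigma> * E u0"
        using renorm_scaleR_less[OF E False _ a] th by simp
      from order_tendstoD(1)[OF renorm_lim this] nc show "\<forall>\<^sub>F u in at u0. theta_bar P \<psi> \<sigma> E u < a"
        by eventually_elim (rule theta_bar_less[OF E _ s], use a th in auto)
    qed
  qed
  then show ?thesis by (simp add: continuous_on_def)
qed

end

section \<open>Degree and eigenvalue of the homogeneous limit\<close>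

lemma class_A1D:
  assumes "E \<in> class_A1"
  shows "E \<in> weak_A1" "b \<le> a \<Longrightarrow> \<not> is_const u \<Longrightarrow> clip a b u \<noteq> u \<Longrightarrow> E (clip a b u) < E u"
  using assms unfolding class_A1_def by blast+

lemma class_A3D:
  assumes "E \<in> class_A3"
  shows "E \<in> class_A1"
    and "(\<And>j. u $ j = vmin u \<Longrightarrow> 0 \<le> v $ j) \<Longrightarrow> (\<And>j. u $ j > vmin u \<Longrightarrow> v $ j = 0) \<Longrightarrow>
      \<exists>D. ((\<lambda>t. E (u + t *\<^sub>R v)) has_real_derivative D) (at_right 0) \<and> D \<le> 0"
  using assms unfolding class_A3_def by blast+

context fractal
begin

lemma is_const_axis: "\<not> is_const (axis l (1 :: real) :: real ^ 'n)"
proof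
  assume "is_const (axis l (1 :: real) :: real ^ 'n)"
  then obtain c where c: "axis l (1 :: real) = (vec c :: real ^ 'n)" by (auto simp: is_const_def)
  obtain j where "j \<noteq> l"
    using card_ge_2 card_le_Suc0_iff_eq[of "UNIV :: 'n set"] by (metis (full_types) UNIV_I finite not_less_eq_eq numeral_2_eq_2)
  then show False
    using arg_cong[OF c, of "\<lambda>u. u $ j"] arg_cong[OF c, of "\<lambda>u. u $ l"] by (simp add: axis_def)
qed

text \<open>Applied to the vector \<open>0\<close>, all of whose entries are minimal, (Q5) and \<open>E \<ge> 0\<close> give
  derivative \<open>0\<close> there in nonnegative directions; a homogeneous functional comparable to \<open>E\<close>
  near \<open>0\<close> therefore has degree larger than \<open>1\<close>.\<close>

lemma witness_degree_gt_1:
  assumes E3: "E \<in> class_A3" and w: "A2_witness P \<psi> E Et p \<rho>"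
  shows "1 < p"
proof (rule ccontr)
  assume "\<not> 1 < p"
  then have p: "p \<le> 1" by simp
  have E: "E \<in> weak_A1" using E3 class_A3D(1) class_A1D(1) by blast
  note Et = A2_witnessD(1)[OF w]
  define v :: "real ^ 'n" where "v = axis undefined 1"
  have v: "0 < Et v" by (simp add: v_def weak_A1_pos[OF Et] is_const_axis)
  have v0: "0 \<le> v $ j" for j by (simp add: v_def axis_def)
  have vmin0: "vmin (0 :: real ^ 'n) = 0" by (rule vmin_eqI) auto
  obtain D where D: "((\<lambda>t. E (0 + t *\<^sub>R v)) has_real_derivative D) (at_right 0)" "D \<le> 0"
    using class_A3D(2)[OF E3, of 0 v] v0 by (auto simp: vmin0)
  have E0: "E 0 = 0" by (simp add: weak_A1D(5)[OF E])
  have "((\<lambda>t. E (t *\<^sub>R v) / t) \<longlongrightarrow> D) (at_right 0)"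
    using D(1) by (simp add: has_field_derivative_iff E0)
  then have ev1: "\<forall>\<^sub>F t in at_right 0. E (t *\<^sub>R v) / t < Et v / 2"
    by (rule order_tendstoD(2)) (use D(2) v in linarith)
  obtain \<delta> where \<delta>: "0 < \<delta>" "\<And>u. osc u < \<delta> \<Longrightarrow> (1 - 1 / 2) * Et u \<le> E u"
    by (rule witness_near_const[OF E w, of "1 / 2"]) (simp, blast)
  have "0 < osc v" by (simp add: osc_pos_iff v_def is_const_axis)
  then have "\<forall>\<^sub>F t in at_right (0 :: real). t \<in> {0 <..< min 1 (\<delta> / osc v)}"
    using \<delta>(1) by (intro eventually_at_right_real) simp
  with ev1 have "\<forall>\<^sub>F t in at_right (0 :: real). False"
  proof eventually_elim
    case (elim t)
    then have t: "0 < t" "t < 1" "t * osc v < \<delta>" using \<open>0 < osc v\<close> by (auto simp: field_simps)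
    have "t \<le> t powr p" using powr_mono'[OF p, of t] t by simp
    then have "t * Et v \<le> t powr p * Et v" using v by (intro mult_right_mono) auto
    also have "\<dots> = Et (t *\<^sub>R v)" using t by (simp add: A2_witnessD(3)[OF w])
    also have "\<dots> \<le> 2 * E (t *\<^sub>R v)" using \<delta>(2)[of "t *\<^sub>R v"] t by (simp add: osc_scaleR)
    finally have "Et v / 2 \<le> E (t *\<^sub>R v) / t" using t by (simp add: field_simps)
    then show ?case using elim(1) by simp
  qed
  then show False by (simp add: trivial_limit_at_right_real)
qed

text \<open>Extending the boundary data that are \<open>1\<close> at one boundary point and \<open>0\<close> at the others by \<open>0\<close>
  gives back their own energy, so the eigenvalue is at most \<open>1\<close>. Raising all interior values to a
  small \<open>t\<close> gains a term of order \<open>t\<close> in the cell of that point and costs only \<open>O(t powr p)\<close> in the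
  cells of the other boundary points.\<close>

lemma witness_eigenvalue_less_1:
  assumes w: "A2_witness P \<psi> E Et p \<rho>" and p: "1 < p"
  shows "\<rho> < 1"
proof -
  note Et = A2_witnessD(1)[OF w]
  define e :: "'n \<Rightarrow> real ^ 'n" where "e l = axis l 1" for l
  define l0 :: 'n where "l0 = undefined"
  define x where "x = Et (e l0)"
  define C where "C = (\<Sum>l\<in>UNIV. Et (e l))"
  define B where "B = real CARD('k) * C"
  have x: "0 < x" by (simp add: x_def e_def weak_A1_pos[OF Et] is_const_axis)
  have C: "Et (e l) \<le> C" for l
    unfolding C_def by (rule member_le_sum) (auto intro: weak_A1D(1)[OF Et])
  have "0 < C" using x C[of l0] by (simp add: x_def)
  then have B: "0 < B" by (simp add: B_def)
  \<comment> \<open>small enough that the cost \<open>t powr p * B\<close> is at most half of the gain \<open>t * x\<close>\<close>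
  define t where "t = min (1 / 2) ((x / (2 * B)) powr (1 / (p - 1)))"
  have t: "0 < t" "t < 1" using x B by (auto simp: t_def)
  have "t powr (p - 1) \<le> ((x / (2 * B)) powr (1 / (p - 1))) powr (p - 1)"
    using t p by (intro powr_mono2) (auto simp: t_def)
  also have "\<dots> = x / (2 * B)" using p x B by (simp add: powr_powr)
  finally have "t powr (p - 1) * B < x" using x B by (simp add: field_simps)
  then have small: "t powr p * B < t * x"
    using t powr_add[of t 1 "p - 1"] by simp
  define v where "v y = (if y = P l0 then 1 else if y \<in> range P then 0 else t)" for y
  have restr: "restr0 P v = e l0"
    using inj_P by (auto simp: restr0_def v_def e_def axis_def vec_eq_iff dest: injD)
  have inner: "\<psi> i (P j) \<notin> range P" if "i \<noteq> \<iota> j" for i j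
    using boundary_point_in_cell that by blast
  have ne: "\<iota> l \<noteq> \<iota> j" if "l \<noteq> j" for l j using inj_\<iota> that by (auto dest: injD)
  have W0: "cells v $ \<iota> l0 = (1 - t) *\<^sub>R e l0 + vec t"
  proof -
    have "v (\<psi> (\<iota> l0) (P j)) = (if j = l0 then 1 else t)" for j
      using inner[of "\<iota> l0" j] ne[of l0 j] by (auto simp: v_def fixed_point)
    then show ?thesis by (simp add: vec_eq_iff e_def axis_def)
  qed
  have W1: "cells v $ \<iota> l = (- t) *\<^sub>R e l + vec t" if "l \<noteq> l0" for l
  proof -
    have "v (\<psi> (\<iota> l) (P j)) = (if j = l then 0 else t)" for j
      using inner[of "\<iota> l" j] ne[of l j] that inj_P by (auto simp: v_def fixed_point dest: injD)
    then show ?thesis by (simp add: vec_eq_iff e_def axis_def)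
  qed
  have W2: "cells v $ i = vec t" if "i \<notin> range \<iota>" for i
  proof -
    have "v (\<psi> i (P j)) = t" for j using inner[of i j] that by (auto simp: v_def)
    then show ?thesis by (simp add: vec_eq_iff)
  qed
  have bound: "Et (cells v $ i) \<le> (if i = \<iota> l0 then (1 - t) * x else 0) + t powr p * C" for i
  proof (cases "i \<in> range \<iota>")
    case False
    have "Et (vec t) = 0" by (simp add: weak_A1D(5)[OF Et])
    then show ?thesis using W2[OF False] False \<open>0 < C\<close> by auto
  next
    case True
    then obtain l where l: "i = \<iota> l" by blast
    show ?thesis
    proof (cases "l = l0")
      case True
      have "Et (cells v $ i) = (1 - t) powr p * x"
        using t True l by (simp add: W0 weak_A1D(3)[OF Et] A2_witnessD(3)[OF w] x_def)
      also have "\<dots> \<le> (1 - t) * x"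
        using powr_mono'[of 1 p "1 - t"] p t x by (intro mult_right_mono) auto
      also have "\<dots> \<le> (1 - t) * x + t powr p * C" using \<open>0 < C\<close> by simp
      finally show ?thesis using True l by simp
    next
      case False
      have "Et (cells v $ i) = t powr p * Et (e l)"
        unfolding l W1[OF False] using t by (simp only: weak_A1D(3)[OF Et] A2_witnessD(3)[OF w]) simp
      also have "\<dots> \<le> t powr p * C" by (intro mult_left_mono C) simp
      finally show ?thesis using l ne[OF False] by simp
    qed
  qed
  have "\<rho> * x = renorm Et (e l0)" by (simp add: A2_witnessD(5)[OF w] x_def)
  also have "\<dots> \<le> cell_sum Et (cells v)"
    using cells_in_extensions[of v] by (intro renorm_le[OF Et]) (simp add: restr)
  also have "\<dots> \<le> (\<Sum>i\<in>UNIV. (if i = \<iota> l0 then (1 - t) * x else 0) + t powr p * C)"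
    unfolding cell_sum_def by (intro sum_mono bound)
  also have "\<dots> = (1 - t) * x + t powr p * B" by (simp add: sum.distrib B_def)
  also have "\<dots> < x" using small by (simp add: left_diff_distrib)
  finally show ?thesis using x by simp
qed

end

section \<open>Contraction of oscillation\<close>

context fractal
begin

text \<open>If a nonconstant cell attains the global minimum only at interior points, raise all interior
  minimum points of the minimizer simultaneously. By (Q5) no cell increases its energy to first
  order. In the given cell the perturbation is a truncation from below, so the energy there strictly
  decreases to first order by strictness in (Q4) and convexity.\<close>

lemma minimizer_min_on_boundary:
  assumes E3: "E \<in> class_A3" and W: "minimizer E u W"
    and nonconst: "\<not> is_const (W $ i)" and min: "W $ i $ j0 = vmin u"
  shows "\<exists>j. W $ i $ j = vmin u \<and> \<psi> i (P j) \<in> range P"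
proof (rule ccontr)
  assume "\<not> ?thesis"
  then have interior: "\<psi> i (P j) \<notin> range P" if "W $ i $ j = vmin u" for j using that by blast
  have E1: "E \<in> class_A1" using E3 class_A3D(1) by blast
  then have E: "E \<in> weak_A1" using class_A1D(1) by blast
  define m where "m = vmin u"
  define D :: "real ^ 'n ^ 'k" where
    "D = (\<chi> i j. if W $ i $ j = m \<and> \<psi> i (P j) \<notin> range P then 1 else 0)"
  have D_nth: "D $ i $ j = (if W $ i $ j = m \<and> \<psi> i (P j) \<notin> range P then 1 else 0)" for i j
    by (simp add: D_def)
  have m_le: "m \<le> W $ i $ j" for i j unfolding m_def by (rule minimizerD(2)[OF W])
  have ext: "W + t *\<^sub>R D \<in> extensions u" for t
  proof (rule extensionsI)
    fix i j i' j' assume eq: "\<psi> i (P j) = \<psi> i' (P j')"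
    then have "W $ i $ j = W $ i' $ j'" using extensionsD(1)[OF minimizerD(1)[OF W]] by blast
    then show "(W + t *\<^sub>R D) $ i $ j = (W + t *\<^sub>R D) $ i' $ j'" by (simp add: D_nth eq)
  next
    fix j show "(W + t *\<^sub>R D) $ \<iota> j $ j = u $ j"
      by (simp add: D_nth fixed_point extensionsD(2)[OF minimizerD(1)[OF W]])
  qed
  have "\<exists>d. ((\<lambda>t. E (W $ i' + t *\<^sub>R D $ i')) has_real_derivative d) (at_right 0) \<and> d \<le> 0" for i'
  proof (rule class_A3D(2)[OF E3])
    fix j assume "vmin (W $ i') < W $ i' $ j"
    moreover obtain j' where "W $ i' $ j' = vmin (W $ i')" using vmin_attained by blast
    ultimately have "W $ i' $ j \<noteq> m" using m_le[of i' j'] by simp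
    then show "D $ i' $ j = 0" by (simp add: D_nth)
  qed (simp add: D_nth)
  then obtain d where d: "\<And>i'. ((\<lambda>t. E (W $ i' + t *\<^sub>R D $ i')) has_real_derivative d i') (at_right 0)"
    "\<And>i'. d i' \<le> 0" by metis
  have Di: "D $ i $ j = (if W $ i $ j = m then 1 else 0)" for j
    using interior by (simp add: D_nth m_def)
  define J where "J = {j. W $ i $ j > m}"
  have "J \<noteq> {}"
  proof
    assume "J = {}"
    then have "\<not> m < W $ i $ j" for j by (auto simp: J_def)
    then have "W $ i $ j = m" for j using m_le[of i j] by (metis order_le_less)
    then have "W $ i = vec m" by (simp add: vec_eq_iff)
    then show False using nonconst by simp
  qed
  \<comment> \<open>distance from the minimum to the next larger value in cell \<open>i\<close>; up to this height raising the
    minimal entries is a truncation from below\<close>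
  define t0 where "t0 = Min ((\<lambda>j. W $ i $ j - m) ` J)"
  have "t0 \<in> (\<lambda>j. W $ i $ j - m) ` J" unfolding t0_def using \<open>J \<noteq> {}\<close> by (intro Min_in) auto
  then have t0: "0 < t0" by (auto simp: J_def)
  have t0_le: "m + t0 \<le> W $ i $ j" if "j \<in> J" for j
  proof -
    have "t0 \<le> W $ i $ j - m" unfolding t0_def using that by (intro Min_le) auto
    then show ?thesis by simp
  qed
  have clip: "W $ i + t0 *\<^sub>R D $ i = clip (vmax (W $ i)) (m + t0) (W $ i)"
  proof -
    have "W $ i $ j + t0 * D $ i $ j = max (min (W $ i $ j) (vmax (W $ i))) (m + t0)" for j
    proof (cases "j \<in> J")
      case True
      then show ?thesis using t0_le[OF True] vmax_ge[of "W $ i" j] by (simp add: Di J_def)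
    next
      case False
      then have "W $ i $ j = m" using m_le[of i j] by (simp add: J_def)
      then show ?thesis using t0 vmax_ge[of "W $ i" j] by (simp add: Di)
    qed
    then show ?thesis by (simp add: clip_def vec_eq_iff)
  qed
  obtain j1 where "j1 \<in> J" using \<open>J \<noteq> {}\<close> by blast
  then have "m + t0 \<le> vmax (W $ i)" using t0_le vmax_ge order_trans by blast
  moreover have "clip (vmax (W $ i)) (m + t0) (W $ i) \<noteq> W $ i"
  proof
    assume "clip (vmax (W $ i)) (m + t0) (W $ i) = W $ i"
    then have "t0 *\<^sub>R D $ i = 0" using clip by simp
    then have "D $ i $ j0 = 0" using t0 by (metis less_irrefl scaleR_eq_0_iff zero_index)
    then show False using min by (simp add: Di m_def)
  qed
  ultimately have less: "E (W $ i + t0 *\<^sub>R D $ i) < E (W $ i)"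
    using class_A1D(2)[OF E1 _ nonconst] clip by simp
  \<comment> \<open>by convexity the negative slope of this secant bounds the derivative at \<open>0\<close>\<close>
  define q where "q = (E (W $ i + t0 *\<^sub>R D $ i) - E (W $ i)) / t0"
  have "q < 0" using less t0 by (simp add: q_def divide_less_0_iff)
  have "((\<lambda>t. (E (W $ i + t *\<^sub>R D $ i) - E (W $ i)) / t) \<longlongrightarrow> d i) (at_right 0)"
    using d(1)[of i] by (simp add: has_field_derivative_iff)
  moreover have "\<forall>\<^sub>F t in at_right 0. (E (W $ i + t *\<^sub>R D $ i) - E (W $ i)) / t \<le> q"
    using eventually_at_right_real[OF t0]
  proof eventually_elim
    case (elim t)
    have "(1 - t / t0) *\<^sub>R (W $ i) + (t / t0) *\<^sub>R (W $ i + t0 *\<^sub>R D $ i) = W $ i + t *\<^sub>R D $ i"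
      using t0 by (simp add: vec_eq_iff field_simps)
    moreover have "E ((1 - t / t0) *\<^sub>R (W $ i) + (t / t0) *\<^sub>R (W $ i + t0 *\<^sub>R D $ i))
        \<le> (1 - t / t0) * E (W $ i) + t / t0 * E (W $ i + t0 *\<^sub>R D $ i)"
      by (rule convex_onD[OF weak_A1D(2)[OF E]]) (use elim in auto)
    ultimately have "E (W $ i + t *\<^sub>R D $ i) - E (W $ i) \<le> t * q"
      using t0 by (simp add: q_def algebra_simps diff_divide_distrib)
    then show ?case using elim by (simp add: field_simps)
  qed
  ultimately have "d i \<le> q"
    by (rule tendsto_upperbound) (simp add: trivial_limit_at_right_real)
  then have "d i < 0" using \<open>q < 0\<close> by simp
  have "(\<Sum>i'\<in>UNIV. d i') < (\<Sum>i'\<in>(UNIV :: 'k set). 0)"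
    by (rule sum_strict_mono2[of UNIV UNIV] | rule sum_strict_mono_ex1) (use d(2) \<open>d i < 0\<close> in auto)
  then have neg: "(\<Sum>i'\<in>UNIV. d i') < 0" by simp
  have "((\<lambda>t. cell_sum E (W + t *\<^sub>R D)) has_real_derivative (\<Sum>i'\<in>UNIV. d i')) (at_right 0)"
    unfolding cell_sum_def vector_add_component vector_scaleR_component
    by (rule DERIV_sum) (rule d(1))
  from has_real_derivative_neg_dec_right[OF this neg]
  obtain h where h: "0 < h" "cell_sum E (W + h *\<^sub>R D) < cell_sum E W"
    by (force dest: spec[of _ "h / 2" for h])
  then show False using minimizerD(4)[OF W ext[of h]] by simp
qed

text \<open>A cell contains at most one boundary point, so it cannot attain both the minimum and the maximum
  of a minimizer at boundary points.\<close>

lemma minimizer_osc_less: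
  assumes E3: "E \<in> class_A3" and W: "minimizer E u W" and u: "\<not> is_const u"
  shows "osc (W $ i) < osc u"
proof (rule ccontr)
  assume "\<not> osc (W $ i) < osc u"
  moreover have "vmin u \<le> vmin (W $ i)" "vmax (W $ i) \<le> vmax u"
    using vmin_attained[of "W $ i"] vmax_attained[of "W $ i"] minimizerD(2,3)[OF W] by metis+
  ultimately have eq: "vmin (W $ i) = vmin u" "vmax (W $ i) = vmax u" by (auto simp: osc_def)
  have E: "E \<in> weak_A1" using E3 class_A3D(1) class_A1D(1) by blast
  have nc: "\<not> is_const (W $ i)" using u eq by (simp add: is_const_iff_osc osc_def)
  obtain a where "W $ i $ a = vmin u" using vmin_attained[of "W $ i"] eq by auto
  then obtain j where j: "W $ i $ j = vmin u" "\<psi> i (P j) \<in> range P"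
    using minimizer_min_on_boundary[OF E3 W nc] by blast
  obtain b where "W $ i $ b = vmax u" using vmax_attained[of "W $ i"] eq by auto
  then have b: "(- W) $ i $ b = vmin (- u)" by (simp add: vmin_uminus)
  have nc': "\<not> is_const ((- W) $ i)" using nc by (simp add: is_const_iff_osc)
  obtain j' where j': "(- W) $ i $ j' = vmin (- u)" "\<psi> i (P j') \<in> range P"
    using minimizer_min_on_boundary[OF E3 minimizer_uminus[OF E W] nc' b] by blast
  have "j = j'"
    using j(2) j'(2) boundary_point_in_cell inj_\<iota> by (metis (no_types, lifting) injD rangeE)
  then have "vmin u = vmax u" using j(1) j'(1) by (simp add: vmin_uminus)
  then show False using u by (simp add: is_const_iff_osc osc_def)
qed

text \<open>The pairs of boundary data and minimizers form a closed set because \<open>renorm E\<close> is continuous; modulo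
  constants it is compact over an annulus of oscillations, where the quotient of the oscillations
  attains its maximum.\<close>

lemma minimizer_osc_contraction:
  assumes E3: "E \<in> class_A3" and \<eta>: "0 < \<eta>"
  obtains \<kappa> where "0 < \<kappa>" "\<kappa> < 1"
    "\<And>u W i. \<eta> \<le> osc u \<Longrightarrow> osc u \<le> R \<Longrightarrow> minimizer E u W \<Longrightarrow> osc (W $ i) \<le> \<kappa> * osc u"
proof -
  have E: "E \<in> weak_A1" using E3 class_A3D(1) class_A1D(1) by blast
  define K where "K = {q :: (real ^ 'n) \<times> (real ^ 'n ^ 'k). (vmin (fst q) = 0 \<and> \<eta> \<le> osc (fst q) \<and> osc (fst q) \<le> R) \<and>
    snd q \<in> extensions (fst q) \<and> (\<forall>i j. vmin (fst q) \<le> snd q $ i $ j \<and> snd q $ i $ j \<le> vmax (fst q)) \<and>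
    cell_sum E (snd q) \<le> renorm E (fst q)}"
  have K_iff: "(u, W) \<in> K \<longleftrightarrow> (vmin u = 0 \<and> \<eta> \<le> osc u \<and> osc u \<le> R) \<and> minimizer E u W" for u W
    using renorm_eq[of E u W] minimizerI[OF E, of W u] minimizerD[of E u W]
    unfolding K_def by auto
  have "closed K"
    unfolding K_def
    by (intro closed_Collect_conj closed_Collect_eq closed_Collect_le closed_Collect_all closed_extensions_graph
      continuous_intros continuous_on_cell_sum[OF E] continuous_on_renorm[OF E])
  moreover have "bounded K"
  proof (rule bounded_subset)
    show "bounded ({u :: real ^ 'n. vmin u = 0 \<and> \<eta> \<le> osc u \<and> osc u \<le> R} \<times> {W :: real ^ 'n ^ 'k. \<forall>i j. 0 \<le> W $ i $ j \<and> W $ i $ j \<le> R})"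
      by (intro bounded_Times bounded_matrix_box compact_imp_bounded compact_normalized_annulus)
    show "K \<subseteq> {u. vmin u = 0 \<and> \<eta> \<le> osc u \<and> osc u \<le> R} \<times> {W. \<forall>i j. 0 \<le> W $ i $ j \<and> W $ i $ j \<le> R}"
      unfolding K_def osc_def by auto (meson order_trans)+
  qed
  ultimately have K: "compact K" by (simp add: compact_eq_bounded_closed)
  have "\<exists>l<1. \<forall>(u, W)\<in>K. osc (W $ i) \<le> l * osc u" for i
  proof (cases "K = {}")
    case True
    then show ?thesis by (auto intro: exI[of _ 0])
  next
    case False
    have "continuous_on K (\<lambda>q. osc (snd q $ i) / osc (fst q))"
      by (intro continuous_intros) (use \<eta> in \<open>auto simp: K_def\<close>)
    from continuous_attains_sup[OF K False this]
    obtain u0 W0 where q: "(u0, W0) \<in> K" "\<forall>q\<in>K. osc (snd q $ i) / osc (fst q) \<le> osc (W0 $ i) / osc u0"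
      by auto
    have pos: "0 < osc u" if "(u, W) \<in> K" for u W using that \<eta> unfolding K_iff by auto
    have "osc (W0 $ i) < osc u0"
      using q(1) pos[OF q(1)] unfolding K_iff by (intro minimizer_osc_less[OF E3]) (auto simp: osc_pos_iff)
    then have "osc (W0 $ i) / osc u0 < 1" using pos[OF q(1)] by simp
    moreover have "osc (W $ i) \<le> osc (W0 $ i) / osc u0 * osc u" if "(u, W) \<in> K" for u W
      using bspec[OF q(2) that] pos[OF that] by (simp add: pos_divide_le_eq)
    ultimately show ?thesis by blast
  qed
  then obtain l where l: "\<And>i. l i < 1" "\<And>i u W. (u, W) \<in> K \<Longrightarrow> osc (W $ i) \<le> l i * osc u"
    by (metis (no_types, lifting) case_prodD)
  define \<kappa> where "\<kappa> = max (1 / 2) (Max (range l))"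
  have l_le: "l i \<le> \<kappa>" for i unfolding \<kappa>_def by (intro max.coboundedI2 Max_ge) auto
  show ?thesis
  proof (rule that[of \<kappa>])
    show "0 < \<kappa>" "\<kappa> < 1" using l(1) by (auto simp: \<kappa>_def)
    fix u W i assume u: "\<eta> \<le> osc u" "osc u \<le> R" and W: "minimizer E u W"
    define c where "c = - vmin u"
    have "minimizer E (u + vec c) (W + (\<chi> i. vec c))" by (rule minimizer_add_vec[OF E W])
    then have "(u + vec c, W + (\<chi> i. vec c)) \<in> K"
      unfolding K_iff using u by (simp add: vmin_add_vec c_def)
    then have "osc ((W + (\<chi> i. vec c)) $ i) \<le> l i * osc (u + vec c)" by (rule l(2))
    also have "\<dots> \<le> \<kappa> * osc (u + vec c)" by (intro mult_right_mono l_le osc_nonneg)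
    finally show "osc (W $ i) \<le> \<kappa> * osc u" by simp
  qed
qed

end

section \<open>Decay of oscillation under iterated rescaled minimization\<close>

locale scaled_energy = fractal P \<iota> \<psi>
  for P :: "'n::finite \<Rightarrow> 'a::metric_space" and \<iota> :: "'n \<Rightarrow> 'k::finite" and \<psi> :: "'k \<Rightarrow> 'a \<Rightarrow> 'a" +
  fixes E :: "real ^ 'n \<Rightarrow> real" and \<sigma> :: real
  assumes E_A4: "E \<in> class_A4 P \<psi>" and \<sigma>_pos: "0 < \<sigma>" and \<sigma>_le_1: "\<sigma> \<le> 1"
begin

abbreviation th :: "real ^ 'n \<Rightarrow> real" where
  "th \<equiv> theta_bar P \<psi> \<sigma> E"

lemma E_A3: "E \<in> class_A3"
  using E_A4 by (simp add: class_A4_def)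

lemma E_weak: "E \<in> weak_A1"
  using E_A3 class_A3D(1) class_A1D(1) by blast

lemma witness_exists: "\<exists>Et p \<rho>. A2_witness P \<psi> E Et p \<rho>"
  using E_A4 by (simp add: class_A4_def class_A2_def)

lemma th_pos: "0 < th u"
  using witness_exists theta_bar_pos[OF E_weak _ \<sigma>_pos] by blast

lemma continuous_th: "continuous_on UNIV th"
  using witness_exists continuous_theta_bar[OF E_weak _ \<sigma>_pos] by blast

text \<open>Optimal values on \<open>V\<^sup>(\<^sup>1\<^sup>)\<close> for the rescaled boundary data; row \<open>i\<close> consists of the boundary data
  that the construction passes on to cell \<open>i\<close>.\<close>

definition best :: "real ^ 'n \<Rightarrow> real ^ 'n ^ 'k" where
  "best u = (SOME W. minimizer E (th u *\<^sub>R u) W)"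

lemma minimizer_best: "minimizer E (th u *\<^sub>R u) (best u)"
  unfolding best_def by (rule someI_ex) (rule minimizer_exists[OF E_weak])

lemma sum_E_best: "(\<Sum>i\<in>UNIV. E (best u $ i)) = \<sigma> * E u"
  using renorm_eq[OF minimizer_best] renorm_theta_bar[OF E_weak \<sigma>_pos] by (simp add: cell_sum_def)

lemma E_best_le: "E (best u $ i) \<le> \<sigma> * E u"
proof -
  have "E (best u $ i) \<le> (\<Sum>i\<in>UNIV. E (best u $ i))"
    by (rule member_le_sum) (auto intro: weak_A1D(1)[OF E_weak])
  then show ?thesis by (simp add: sum_E_best)
qed

lemma E_best_le_E: "E (best u $ i) \<le> E u"
  using E_best_le[of u i] mult_right_mono[OF \<sigma>_le_1 weak_A1D(1)[OF E_weak, of u]] by simp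

lemma osc_best_le: "osc (best u $ i) \<le> th u * osc u"
  using minimizer_osc_le[OF minimizer_best, of u i] th_pos[of u] by (simp add: osc_scaleR)

text \<open>For small oscillations the bound comes from the homogeneous \<open>Et\<close>, for the others from coercivity,
  as \<open>osc u \<le> R\<close> bounds \<open>osc u powr (p - 1)\<close>.\<close>

lemma E_lower_bound:
  assumes w: "A2_witness P \<psi> E Et p \<rho>" and p: "1 < p"
  obtains c where "0 < c" "\<And>u. osc u \<le> R \<Longrightarrow> c * osc u powr p \<le> E u"
proof -
  note Et = A2_witnessD(1)[OF w]
  obtain \<delta> where \<delta>: "0 < \<delta>" "\<And>u. osc u < \<delta> \<Longrightarrow> (1 - 1 / 2) * Et u \<le> E u"
    by (rule witness_near_const[OF E_weak w, of "1 / 2"]) (simp, blast)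
  obtain e where e: "0 < e" "\<And>u. 1 \<le> osc u \<Longrightarrow> e * osc u \<le> Et u"
    using weak_A1_coercive[OF Et, of 1] by auto
  obtain e' where e': "0 < e'" "\<And>u. \<delta> \<le> osc u \<Longrightarrow> e' * osc u \<le> E u"
    using weak_A1_coercive[OF E_weak \<delta>(1)] by blast
  define R' where "R' = max 1 R"
  define c where "c = min (e / 2) (e' / R' powr (p - 1))"
  have R': "0 < R'" by (simp add: R'_def)
  then have c: "0 < c" using e e' by (simp add: c_def)
  have "c * osc u powr p \<le> E u" if R: "osc u \<le> R" for u
  proof (cases "is_const u")
    case True
    then show ?thesis by (simp add: is_const_iff_osc weak_A1D(1)[OF E_weak])
  next
    case False
    then have pos: "0 < osc u" by (simp add: osc_pos_iff)
    show ?thesis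
    proof (cases "osc u < \<delta>")
      case True
      define v where "v = (1 / osc u) *\<^sub>R u"
      have "osc v = 1" using pos by (simp add: v_def osc_scaleR)
      then have "e \<le> Et v" using e(2)[of v] by simp
      have "c \<le> e / 2" unfolding c_def by (rule min.cobounded1)
      then have "c * osc u powr p \<le> e / 2 * osc u powr p" by (intro mult_right_mono) auto
      also have "\<dots> \<le> 1 / 2 * (osc u powr p * Et v)" using \<open>e \<le> Et v\<close> by (simp add: mult.commute[of e] mult_left_mono)
      also have "osc u powr p * Et v = Et (osc u *\<^sub>R v)" using pos by (simp add: A2_witnessD(3)[OF w])
      also have "osc u *\<^sub>R v = u" using pos by (simp add: v_def)
      also have "1 / 2 * Et u \<le> E u" using \<delta>(2)[OF True] by simp
      finally show ?thesis .
    next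
      case False
      have "c * osc u powr p = c * osc u powr (p - 1) * osc u"
        using pos powr_add[of "osc u" "p - 1" 1] by simp
      also have "\<dots> \<le> c * R' powr (p - 1) * osc u"
        using pos p R c by (intro mult_right_mono mult_left_mono powr_mono2) (auto simp: R'_def)
      also have "\<dots> \<le> e' * osc u"
      proof (rule mult_right_mono)
        have "c \<le> e' / R' powr (p - 1)" unfolding c_def by (rule min.cobounded2)
        then have "c * R' powr (p - 1) \<le> e' / R' powr (p - 1) * R' powr (p - 1)"
          by (intro mult_right_mono) auto
        then show "c * R' powr (p - 1) \<le> e'" using R' by simp
      qed (use pos in simp)
      also have "\<dots> \<le> E u" using e'(2) False by simp
      finally show ?thesis .
    qed
  qed
  then show ?thesis using c that by blast
qed

text \<open>In passing from \<open>u\<close> to \<open>best u $ i\<close> the data are rescaled by \<open>th u\<close>, so what has to decrease is the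
  oscillation relative to \<open>th u\<close> times the old one, or the energy relative to \<open>th u powr p\<close> times the
  old one. The relative oscillation never increases, and it contracts if \<open>osc u\<close> is bounded below. The
  relative energy is multiplied by at most \<open>\<sigma> / th u powr p\<close>, which is bounded, and close to \<open>\<rho>\<close> if
  \<open>osc u\<close> is small. Hence a product of a high power of the oscillation with the energy contracts in both
  cases. Near the constants this product is asymptotically homogeneous of degree \<open>q = n + p\<close>, so its
  \<open>q\<close>-th root, which up to a constant factor is \<open>d\<close>, can be compared with the oscillation.\<close>

lemma decay_potential:
  obtains d :: "real ^ 'n \<Rightarrow> real" and \<nu> where "0 < \<nu>" "\<nu> < 1"
    "\<And>u. E u \<le> c \<Longrightarrow> osc u \<le> d u"
    "\<And>u i. E u \<le> c \<Longrightarrow> d (best u $ i) \<le> \<nu> * (th u * d u)"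
proof -
  obtain Et p \<rho> where w: "A2_witness P \<psi> E Et p \<rho>" using witness_exists by blast
  have p: "1 < p" by (rule witness_degree_gt_1[OF E_A3 w])
  have \<rho>: "0 < \<rho>" "\<rho> < 1" using A2_witnessD(4)[OF w] witness_eigenvalue_less_1[OF w p] by auto
  obtain R where R: "\<And>u. E u \<le> c \<Longrightarrow> osc u \<le> R" using osc_bounded_on_sublevel[OF E_weak] by blast
  obtain a b where ab: "0 < a" "a \<le> b" "\<And>u. osc u \<le> R \<Longrightarrow> a \<le> th u" "\<And>u. osc u \<le> R \<Longrightarrow> th u \<le> b"
    by (rule continuous_on_shift_invariant_bounds[OF continuous_th th_pos theta_bar_add_vec[OF E_weak], where R = R])
       blast
  define \<mu> where "\<mu> = (1 + \<rho>) / 2"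
  have \<mu>: "0 < \<mu>" "\<mu> < 1" "\<rho> < \<mu>" using \<rho> by (auto simp: \<mu>_def)
  have "(\<sigma> / \<mu>) powr (1 / p) < (\<sigma> / \<rho>) powr (1 / p)"
    using \<mu> \<rho> \<sigma>_pos p by (intro powr_less_mono2) (auto simp: field_simps)
  moreover have "0 < (\<sigma> / \<mu>) powr (1 / p)" using \<mu> \<sigma>_pos by simp
  ultimately obtain \<eta> where \<eta>: "0 < \<eta>"
    "\<And>u. \<not> is_const u \<Longrightarrow> osc u < \<eta> \<Longrightarrow> (\<sigma> / \<mu>) powr (1 / p) < th u"
    using theta_bar_near_const(1)[OF E_weak w \<sigma>_pos] by blast
  have small: "\<sigma> \<le> \<mu> * th u powr p" if u: "\<not> is_const u" "osc u < \<eta>" for u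
  proof -
    have "\<sigma> / \<mu> < th u powr p"
      using \<eta>(2)[OF u] less_powr_iff(2)[of p "th u" "\<sigma> / \<mu>"] p th_pos[of u] \<sigma>_pos \<mu> by simp
    then show ?thesis using \<mu> by (simp add: field_simps)
  qed
  have "0 < a * \<eta>" using ab \<eta> by simp
  then obtain \<kappa> where \<kappa>: "0 < \<kappa>" "\<kappa> < 1"
    "\<And>u W i. a * \<eta> \<le> osc u \<Longrightarrow> osc u \<le> b * R \<Longrightarrow> minimizer E u W \<Longrightarrow> osc (W $ i) \<le> \<kappa> * osc u"
    using minimizer_osc_contraction[OF E_A3, of "a * \<eta>" "b * R"] by blast
  have large: "osc (best u $ i) \<le> \<kappa> * (th u * osc u)" if u: "\<eta> \<le> osc u" "osc u \<le> R" for u i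
  proof -
    have osc: "osc (th u *\<^sub>R u) = th u * osc u" using th_pos[of u] by (simp add: osc_scaleR)
    have "a * \<eta> \<le> th u * osc u" using ab(1) ab(3)[OF u(2)] u(1) \<eta>(1) by (intro mult_mono) auto
    moreover have "th u * osc u \<le> b * R"
      using ab(1,2) ab(4)[OF u(2)] u(2) by (intro mult_mono) (auto simp: osc_nonneg)
    ultimately show ?thesis using \<kappa>(3)[OF _ _ minimizer_best, of u i] osc by simp
  qed
  \<comment> \<open>power of the oscillation whose contraction outweighs the possible growth \<open>\<sigma> / a powr p\<close> of the
    relative energy\<close>
  obtain n where n: "\<kappa> ^ n < a powr p / (2 * \<sigma>)"
    using real_arch_pow_inv[OF _ \<kappa>(2), of "a powr p / (2 * \<sigma>)"] ab(1) \<sigma>_pos by auto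
  define q where "q = real n + p"
  have q: "0 < q" using p by (simp add: q_def)
  define \<nu>0 where "\<nu>0 = max (1 / 2) \<mu>"
  have \<nu>0: "0 < \<nu>0" "\<nu>0 < 1" using \<mu> by (auto simp: \<nu>0_def)
  define Z where "Z u = osc u ^ n * E u" for u
  have Z_nonneg: "0 \<le> Z u" for u by (simp add: Z_def osc_nonneg weak_A1D(1)[OF E_weak])
  have Z_step: "Z (best u $ i) \<le> \<nu>0 * (th u powr q * Z u)" if "E u \<le> c" for u i
  proof (cases "is_const u")
    case True
    have "E (best u $ i) \<le> 0" using E_best_le[of u i] True weak_A1D(5)[OF E_weak, of u] by simp
    then have "Z (best u $ i) \<le> 0" unfolding Z_def
      by (intro mult_nonneg_nonpos) (auto simp: osc_nonneg)
    also have "0 \<le> \<nu>0 * (th u powr q * Z u)" using \<nu>0 Z_nonneg by simp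
    finally show ?thesis .
  next
    case False
    have E0: "0 \<le> E u" by (rule weak_A1D(1)[OF E_weak])
    have t: "0 < th u" by (rule th_pos)
    have uR: "osc u \<le> R" by (rule R[OF that])
    have th_q: "th u powr q = th u ^ n * th u powr p"
      using t by (simp add: q_def powr_add powr_realpow)
    have goal: "Z (best u $ i) \<le> \<nu>0 * (th u powr q * Z u)"
      if "osc (best u $ i) ^ n \<le> k * (th u * osc u) ^ n" "0 \<le> k" "k * \<sigma> \<le> \<nu>0 * th u powr p" for k
    proof -
      have "Z (best u $ i) \<le> (k * (th u * osc u) ^ n) * (\<sigma> * E u)"
        unfolding Z_def using that th_pos[of u]
        by (intro mult_mono E_best_le) (auto intro: weak_A1D(1)[OF E_weak] simp: osc_nonneg)
      also have "\<dots> = (k * \<sigma>) * ((th u * osc u) ^ n * E u)" by simp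
      also have "\<dots> \<le> (\<nu>0 * th u powr p) * ((th u * osc u) ^ n * E u)"
        using that(3) t E0 by (intro mult_right_mono) (auto simp: osc_nonneg)
      also have "\<dots> = \<nu>0 * (th u powr q * Z u)" by (simp add: th_q Z_def power_mult_distrib)
      finally show ?thesis .
    qed
    show ?thesis
    proof (cases "osc u < \<eta>")
      case True
      have "osc (best u $ i) ^ n \<le> 1 * (th u * osc u) ^ n"
        using osc_best_le by (simp add: power_mono osc_nonneg)
      moreover have "1 * \<sigma> \<le> \<nu>0 * th u powr p"
      proof -
        have "\<sigma> \<le> \<mu> * th u powr p" using small[OF False True] .
        also have "\<dots> \<le> \<nu>0 * th u powr p" by (intro mult_right_mono) (auto simp: \<nu>0_def)
        finally show ?thesis by simp
      qed
      ultimately show ?thesis by (intro goal[of 1]) auto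
    next
      case False
      have "osc (best u $ i) ^ n \<le> (\<kappa> * (th u * osc u)) ^ n"
        using large[OF _ uR, of i] False by (intro power_mono) (auto simp: osc_nonneg)
      then have "osc (best u $ i) ^ n \<le> \<kappa> ^ n * (th u * osc u) ^ n" by (simp add: power_mult_distrib)
      moreover have "\<kappa> ^ n * \<sigma> \<le> \<nu>0 * th u powr p"
      proof -
        have "\<kappa> ^ n * \<sigma> \<le> 1 / 2 * a powr p" using n \<sigma>_pos by (simp add: field_simps)
        also have "\<dots> \<le> \<nu>0 * th u powr p"
          using ab(1) ab(3)[OF uR] p by (intro mult_mono powr_mono2) (auto simp: \<nu>0_def)
        finally show ?thesis .
      qed
      ultimately show ?thesis using \<kappa>(1) by (intro goal[of "\<kappa> ^ n"]) auto
    qed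
  qed
  obtain c1 where c1: "0 < c1" "\<And>u. osc u \<le> R \<Longrightarrow> c1 * osc u powr p \<le> E u"
    using E_lower_bound[OF w p] by blast
  define d where "d u = (Z u / c1) powr (1 / q)" for u
  have root: "(x powr q) powr (1 / q) = x" if "0 \<le> x" for x using that q by (simp add: powr_powr)
  show ?thesis
  proof (rule that[of "\<nu>0 powr (1 / q)" d])
    show "0 < \<nu>0 powr (1 / q)" using \<nu>0 by simp
    show "\<nu>0 powr (1 / q) < 1" using \<nu>0 q powr_less_mono2[of "1 / q" \<nu>0 1] by simp
  next
    fix u assume "E u \<le> c"
    show "osc u \<le> d u"
    proof (cases "osc u = 0")
      case False
      then have pos: "0 < osc u" using osc_nonneg[of u] by simp
      have "c1 * osc u powr q = osc u ^ n * (c1 * osc u powr p)"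
        using pos by (simp add: q_def powr_add powr_realpow)
      also have "\<dots> \<le> Z u"
        unfolding Z_def using pos c1(2)[OF R[OF \<open>E u \<le> c\<close>]] by (intro mult_left_mono) auto
      finally have "osc u powr q \<le> Z u / c1" using c1(1) by (simp add: field_simps)
      then have "(osc u powr q) powr (1 / q) \<le> d u"
        unfolding d_def using q by (intro powr_mono2) auto
      then show ?thesis using root[OF osc_nonneg[of u]] by simp
    qed (simp add: d_def)
  next
    fix u i assume "E u \<le> c"
    have "d (best u $ i) \<le> (\<nu>0 * (th u powr q * Z u) / c1) powr (1 / q)"
      unfolding d_def using q c1(1) Z_nonneg Z_step[OF \<open>E u \<le> c\<close>]
      by (intro powr_mono2 divide_right_mono) auto
    also have "\<dots> = (\<nu>0 * (th u powr q * (Z u / c1))) powr (1 / q)" by simp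
    also have "\<dots> = \<nu>0 powr (1 / q) * ((th u powr q) powr (1 / q) * d u)"
      unfolding d_def using \<nu>0 c1(1) Z_nonneg by (simp only: powr_mult)
    also have "\<dots> = \<nu>0 powr (1 / q) * (th u * d u)" using root[OF less_imp_le[OF th_pos[of u]]] by simp
    finally show "d (best u $ i) \<le> \<nu>0 powr (1 / q) * (th u * d u)" .
  qed
qed

end

section \<open>Gluing continuous functions on the cells\<close>

context fractal
begin

lemma bcomp_apply [simp]: "apply_bcontfun (bcomp v (\<psi> i)) x = v (\<psi> i x)"
  by (simp add: apply_bcomp[OF continuous_\<psi>])

lemma in_some_cell: "\<exists>i y. x = \<psi> i y"
  using self_similar_space by blast

lemma cell_overlap:
  assumes "i \<noteq> i'" "\<psi> i y = \<psi> i' y'"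
  shows "\<exists>j j'. y = P j \<and> y' = P j'"
proof -
  have "range (\<psi> i) \<inter> range (\<psi> i') = \<psi> i ` range P \<inter> \<psi> i' ` range P"
    using cell_inter[of "[i]" "[i']"] assms(1) by simp
  then have "\<psi> i y \<in> \<psi> i ` range P \<inter> \<psi> i' ` range P" using assms(2) by (metis Int_iff rangeI)
  then have "\<psi> i y \<in> \<psi> i ` range P" "\<psi> i' y' \<in> \<psi> i' ` range P" using assms(2) by auto
  then show ?thesis using inj_\<psi> by (auto simp: inj_image_mem_iff)
qed

text \<open>Distinct cells meet in images of boundary points only, so functions on the cells that agree at
  these points define a function on the whole space; it is continuous on each of the finitely many
  closed cells.\<close>

lemma glue_exists:
  fixes g :: "'k \<Rightarrow> 'a \<Rightarrow>\<^sub>C real"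
  assumes "\<And>i j i' j'. \<psi> i (P j) = \<psi> i' (P j') \<Longrightarrow> g i (P j) = g i' (P j')"
  shows "\<exists>G. \<forall>i. bcomp G (\<psi> i) = g i"
proof -
  have well_defined: "g i y = g i' y'" if eq: "\<psi> i y = \<psi> i' y'" for i i' y y'
  proof (cases "i = i'")
    case True
    then show ?thesis using eq inj_\<psi>[of i'] by (simp add: inj_eq)
  next
    case False
    then obtain j j' where yy': "y = P j" "y' = P j'" using cell_overlap[OF False eq] by blast
    then have "\<psi> i (P j) = \<psi> i' (P j')" using eq by simp
    from assms[OF this] show ?thesis unfolding yy' .
  qed
  define G where "G x = (SOME r. \<exists>i y. x = \<psi> i y \<and> r = g i y)" for x
  have G: "G (\<psi> i y) = g i y" for i y
    unfolding G_def by (rule some_equality) (blast, metis well_defined)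
  have "continuous_on (range (\<psi> i)) G" for i
  proof -
    have inv: "inv (\<psi> i) (\<psi> i y) = y" for y by (rule inv_f_f[OF inj_\<psi>])
    have "continuous_on (range (\<psi> i)) (inv (\<psi> i))"
      by (rule continuous_on_inv[OF continuous_\<psi> compact_space]) (simp add: inv)
    then have "continuous_on (range (\<psi> i)) (\<lambda>x. g i (inv (\<psi> i) x))"
      by (rule continuous_on_compose2[OF continuous_on_apply_bcontfun[of UNIV]]) auto
    then show ?thesis
      by (rule continuous_on_eq) (auto simp: G inv)
  qed
  moreover have "closed (range (\<psi> i))" for i
    by (intro compact_imp_closed compact_continuous_image continuous_\<psi> compact_space)
  ultimately have "continuous_on (\<Union>i\<in>UNIV. range (\<psi> i)) G"
    by (intro continuous_on_closed_Union) auto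
  then have cont: "continuous_on UNIV G" by (simp add: self_similar_space)
  have "bounded (range G)"
    by (intro compact_imp_bounded compact_continuous_image cont compact_space)
  with cont have "G \<in> bcontfun" by (simp add: bcontfun_def)
  then have "apply_bcontfun (Bcontfun G) = G" by (rule Bcontfun_inverse)
  then show ?thesis
    using G by (intro exI[of _ "Bcontfun G"] allI bcontfun_eqI) simp
qed

definition glue :: "('k \<Rightarrow> 'a \<Rightarrow>\<^sub>C real) \<Rightarrow> 'a \<Rightarrow>\<^sub>C real" where
  "glue g = (SOME G. \<forall>i. bcomp G (\<psi> i) = g i)"

lemma glue:
  fixes g :: "'k \<Rightarrow> 'a \<Rightarrow>\<^sub>C real"
  assumes W: "W \<in> extensions u" and g: "\<And>i. restr0 P (g i) = W $ i"
  shows "bcomp (glue g) (\<psi> i) = g i" "restr0 P (glue g) = u"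
proof -
  have val: "g i (P j) = W $ i $ j" for i j using g[of i] by (auto simp: restr0_def vec_eq_iff)
  have "\<exists>G. \<forall>i. bcomp G (\<psi> i) = g i"
    by (rule glue_exists) (simp only: val, rule extensionsD(1)[OF W])
  then have *: "\<forall>i. bcomp (glue g) (\<psi> i) = g i" unfolding glue_def by (rule someI_ex)
  then show "bcomp (glue g) (\<psi> i) = g i" by blast
  have "glue g (P j) = u $ j" for j
    using arg_cong[OF spec[OF *, of "\<iota> j"], of "\<lambda>f. apply_bcontfun f (P j)"] val[of "\<iota> j" j]
      extensionsD(2)[OF W, of j]
    by (simp add: fixed_point)
  then show "restr0 P (glue g) = u" by (simp add: restr0_def vec_eq_iff)
qed

lemma glue_apply:
  fixes g :: "'k \<Rightarrow> 'a \<Rightarrow>\<^sub>C real"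
  assumes "W \<in> extensions u" and "\<And>i. restr0 P (g i) = W $ i"
  shows "glue g (\<psi> i y) = g i y"
  using glue(1)[OF assms, of i] by (metis bcomp_apply)

lemma restr0_scaleR: "restr0 P (apply_bcontfun (c *\<^sub>R v)) = c *\<^sub>R restr0 P v"
  by (simp add: restr0_def vec_eq_iff)

lemma restr0_bcomp: "restr0 P (bcomp v (\<psi> i)) = cells v $ i"
  by (simp add: restr0_def vec_eq_iff)

text \<open>Inverse distance weights, with denominators cleared.\<close>

lemma interpolation_exists:
  "\<exists>f :: 'a \<Rightarrow>\<^sub>C real. restr0 P f = u \<and> (\<forall>x. vmin u \<le> f x \<and> f x \<le> vmax u)"
proof -
  define w where "w j x = (\<Prod>l\<in>UNIV - {j}. dist x (P l))" for j x
  define D where "D x = (\<Sum>j\<in>UNIV. w j x)" for x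
  define f where "f x = (\<Sum>j\<in>UNIV. w j x * u $ j) / D x" for x
  have w0: "0 \<le> w j x" for j x unfolding w_def by (intro prod_nonneg) auto
  have w_P: "w j (P l) = 0" if "j \<noteq> l" for j l unfolding w_def using that by auto
  have w_pos: "0 < w l (P l)" for l
    unfolding w_def using inj_P by (intro prod_pos) (auto dest: injD)
  have D: "0 < D x" for x
  proof (cases "x \<in> range P")
    case True
    then obtain l where "x = P l" by blast
    then have "0 < w l x" using w_pos by simp
    then show ?thesis unfolding D_def by (intro sum_pos2[of _ l]) (auto simp: w0)
  next
    case False
    then have "0 < w j x" for j unfolding w_def by (intro prod_pos) auto
    then show ?thesis unfolding D_def by (intro sum_pos) auto
  qed
  have cont: "continuous_on UNIV f"
    unfolding f_def D_def w_def
    by (intro continuous_intros) (use D in \<open>auto simp: D_def w_def less_imp_neq[THEN not_sym]\<close>)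
  have f_P: "f (P l) = u $ l" for l
  proof -
    have "(\<Sum>j\<in>UNIV. w j (P l) * u $ j) = (\<Sum>j\<in>{l}. w j (P l) * u $ j)"
      by (rule sum.mono_neutral_right) (auto simp: w_P)
    moreover have "D (P l) = (\<Sum>j\<in>{l}. w j (P l))"
      unfolding D_def by (rule sum.mono_neutral_right) (auto simp: w_P)
    ultimately show ?thesis using w_pos[of l] by (simp add: f_def)
  qed
  have bounds: "vmin u \<le> f x \<and> f x \<le> vmax u" for x
  proof
    have "vmin u * D x \<le> (\<Sum>j\<in>UNIV. w j x * u $ j)"
      unfolding D_def sum_distrib_left
      by (intro sum_mono) (metis mult.commute mult_left_mono w0 vmin_le)
    then show "vmin u \<le> f x" using D[of x] by (simp add: f_def pos_le_divide_eq)
    have "(\<Sum>j\<in>UNIV. w j x * u $ j) \<le> vmax u * D x"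
      unfolding D_def sum_distrib_left
      by (intro sum_mono) (metis mult.commute mult_left_mono w0 vmax_ge)
    then show "f x \<le> vmax u" using D[of x] by (simp add: f_def pos_divide_le_eq)
  qed
  have "bounded (range f)" by (intro compact_imp_bounded compact_continuous_image cont compact_space)
  with cont have "f \<in> bcontfun" by (simp add: bcontfun_def)
  then have "apply_bcontfun (Bcontfun f) = f" by (rule Bcontfun_inverse)
  then show ?thesis
    using f_P bounds by (intro exI[of _ "Bcontfun f"]) (simp add: restr0_def vec_eq_iff)
qed

end

section \<open>Extensions of minimal energy\<close>

context scaled_energy
begin

definition interpolation :: "real ^ 'n \<Rightarrow> 'a \<Rightarrow>\<^sub>C real" where
  "interpolation u = (SOME f :: 'a \<Rightarrow>\<^sub>C real. restr0 P f = u \<and> (\<forall>x. vmin u \<le> f x \<and> f x \<le> vmax u))"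

text \<open>The minimizers \<open>best\<close> are inserted on \<open>n\<close> levels of cells, an arbitrary continuous
  interpolation below.\<close>

primrec partial_ext :: "nat \<Rightarrow> real ^ 'n \<Rightarrow> 'a \<Rightarrow>\<^sub>C real" where
  "partial_ext 0 u = interpolation u"
| "partial_ext (Suc n) u = glue (\<lambda>i. (1 / th u) *\<^sub>R partial_ext n (best u $ i))"

lemma interpolation:
  "restr0 P (interpolation u) = u" "vmin u \<le> interpolation u x" "interpolation u x \<le> vmax u"
  using someI_ex[OF interpolation_exists[of u]] unfolding interpolation_def by blast+

lemma best_rescaled: "(1 / th u) *\<^sub>R best u \<in> extensions u"
  using minimizerD(1)[OF minimizer_best, of u] th_pos[of u] extensions_scaleR_iff[of "th u"] by simp

lemma restr0_partial_ext: "restr0 P (partial_ext n u) = u"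
proof (induction n arbitrary: u)
  case 0
  then show ?case by (simp add: interpolation)
next
  case (Suc n)
  show ?case unfolding partial_ext.simps
    by (rule glue(2)[OF best_rescaled[of u]]) (simp only: restr0_scaleR Suc vector_scaleR_component)
qed

lemma partial_ext_cell: "partial_ext (Suc n) u (\<psi> i y) = partial_ext n (best u $ i) y / th u"
proof -
  have "partial_ext (Suc n) u (\<psi> i y) = ((1 / th u) *\<^sub>R partial_ext n (best u $ i)) y"
    unfolding partial_ext.simps
    by (rule glue_apply[OF best_rescaled[of u]]) (simp only: restr0_scaleR restr0_partial_ext vector_scaleR_component)
  then show ?thesis by simp
qed

lemma best_bounds: "th u * vmin u \<le> vmin (best u $ i)" "vmax (best u $ i) \<le> th u * vmax u"
proof -
  have "vmin (th u *\<^sub>R u) \<le> vmin (best u $ i)"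
    using vmin_attained[of "best u $ i"] minimizerD(2)[OF minimizer_best] by metis
  then show "th u * vmin u \<le> vmin (best u $ i)" using th_pos[of u] by (simp add: vmin_scaleR)
  have "vmax (best u $ i) \<le> vmax (th u *\<^sub>R u)"
    using vmax_attained[of "best u $ i"] minimizerD(3)[OF minimizer_best] by metis
  then show "vmax (best u $ i) \<le> th u * vmax u" using th_pos[of u] by (simp add: vmax_scaleR)
qed

lemma partial_ext_bounds: "vmin u \<le> partial_ext n u x \<and> partial_ext n u x \<le> vmax u"
proof (induction n arbitrary: u x)
  case 0
  then show ?case by (simp add: interpolation)
next
  case (Suc n)
  obtain i y where x: "x = \<psi> i y" using in_some_cell by blast
  have "th u * vmin u \<le> partial_ext n (best u $ i) y" "partial_ext n (best u $ i) y \<le> th u * vmax u"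
    using Suc[of "best u $ i" y] best_bounds[of u i] by linarith+
  then show ?case using th_pos[of u] by (simp only: x partial_ext_cell) (simp add: field_simps)
qed

text \<open>Two of these functions of level at least \<open>n\<close> take, on each cell of level \<open>n\<close>, values between the
  same bounds, whose distance is the oscillation of the data passed on to that cell, measured in the
  original scale.\<close>

lemma partial_ext_Cauchy: "Cauchy (\<lambda>n. partial_ext n u)"
proof -
  obtain d :: "real ^ 'n \<Rightarrow> real" and \<nu> where \<nu>: "0 < \<nu>" "\<nu> < 1"
    and d: "\<And>v. E v \<le> E u \<Longrightarrow> osc v \<le> d v"
      "\<And>v i. E v \<le> E u \<Longrightarrow> d (best v $ i) \<le> \<nu> * (th v * d v)"
    by (rule decay_potential[of "E u"]) (rule that)
  have close: "\<bar>partial_ext n v x - partial_ext (n + m) v x\<bar> \<le> \<nu> ^ n * d v" if "E v \<le> E u" for n m v x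
    using that
  proof (induction n arbitrary: v x)
    case 0
    then show ?case
      using partial_ext_bounds[of v 0 x] partial_ext_bounds[of v m x] d(1)[OF 0] by (simp add: osc_def abs_le_iff)
  next
    case (Suc n)
    obtain i y where x: "x = \<psi> i y" using in_some_cell by blast
    have "\<bar>partial_ext (Suc n) v x - partial_ext (Suc (n + m)) v x\<bar>
        = \<bar>partial_ext n (best v $ i) y - partial_ext (n + m) (best v $ i) y\<bar> / th v"
      using th_pos[of v] by (simp only: x partial_ext_cell) (simp flip: diff_divide_distrib)
    also have "\<dots> \<le> (\<nu> ^ n * d (best v $ i)) / th v"
      using Suc.IH[of "best v $ i" y] E_best_le_E[of v i] Suc.prems th_pos[of v]
      by (intro divide_right_mono) auto
    also have "\<dots> \<le> (\<nu> ^ n * (\<nu> * (th v * d v))) / th v"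
      using d(2)[OF Suc.prems] \<nu> th_pos[of v] by (intro divide_right_mono mult_left_mono) auto
    also have "\<dots> = \<nu> ^ Suc n * d v" using th_pos[of v] by simp
    finally show ?case by simp
  qed
  have dist: "dist (partial_ext n u) (partial_ext (n + m) u) \<le> \<nu> ^ n * d u" for n m
    by (rule dist_bound) (use close in \<open>simp add: dist_real_def\<close>)
  have "(\<lambda>n. \<nu> ^ n * d u) \<longlonglongrightarrow> 0"
    using \<nu> by (intro tendsto_mult_left_zero LIMSEQ_power_zero) simp
  show ?thesis
  proof (rule metric_CauchyI)
    fix e :: real assume "0 < e"
    then have "\<forall>\<^sub>F n in sequentially. \<nu> ^ n * d u < e / 2"
      by (intro order_tendstoD(2)[OF \<open>(\<lambda>n. \<nu> ^ n * d u) \<longlonglongrightarrow> 0\<close>]) simp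
    then obtain M where M: "\<nu> ^ M * d u < e / 2" by (auto simp: eventually_sequentially)
    have near: "dist (partial_ext n u) (partial_ext M u) < e / 2" if "M \<le> n" for n
      using dist[of M "n - M"] that M by (simp add: dist_commute)
    have "dist (partial_ext m u) (partial_ext n u) < e" if "M \<le> m" "M \<le> n" for m n
      using near[OF that(1)] near[OF that(2)] dist_triangle2[of "partial_ext m u" "partial_ext n u" "partial_ext M u"]
      by linarith
    then show "\<exists>M. \<forall>m\<ge>M. \<forall>n\<ge>M. dist (partial_ext m u) (partial_ext n u) < e" by blast
  qed
qed

definition min_ext :: "real ^ 'n \<Rightarrow> 'a \<Rightarrow>\<^sub>C real" where
  "min_ext u = lim (\<lambda>n. partial_ext n u)"

lemma partial_ext_tendsto: "(\<lambda>n. partial_ext n u x) \<longlonglongrightarrow> min_ext u x"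
proof -
  have "(\<lambda>n. partial_ext n u) \<longlonglongrightarrow> min_ext u"
    unfolding min_ext_def using partial_ext_Cauchy Cauchy_convergent convergent_LIMSEQ_iff by blast
  from tendsto_bcontfun_uniform_limit[OF this] show ?thesis
    by (rule tendsto_uniform_limitI) simp
qed

lemma min_ext_bounds: "vmin u \<le> min_ext u x" "min_ext u x \<le> vmax u"
  using partial_ext_bounds
  by (auto intro!: LIMSEQ_le_const[OF partial_ext_tendsto] LIMSEQ_le_const2[OF partial_ext_tendsto])

lemma restr0_min_ext: "restr0 P (min_ext u) = u"
proof -
  have "partial_ext n u (P j) = u $ j" for n j
    using arg_cong[OF restr0_partial_ext[of n u], of "\<lambda>w. w $ j"] by (simp add: restr0_def)
  then have "min_ext u (P j) = u $ j" for j
    using LIMSEQ_unique[OF partial_ext_tendsto[of u "P j"]] by simp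
  then show ?thesis by (simp add: restr0_def vec_eq_iff)
qed

lemma min_ext_cell: "th u *\<^sub>R bcomp (min_ext u) (\<psi> i) = min_ext (best u $ i)"
proof (rule bcontfun_eqI)
  fix y
  have "(\<lambda>n. partial_ext (Suc n) u (\<psi> i y)) \<longlonglongrightarrow> min_ext u (\<psi> i y)"
    by (rule LIMSEQ_Suc[OF partial_ext_tendsto])
  moreover have "(\<lambda>n. partial_ext (Suc n) u (\<psi> i y)) \<longlonglongrightarrow> min_ext (best u $ i) y / th u"
    unfolding partial_ext_cell using th_pos[of u] by (intro tendsto_intros partial_ext_tendsto) simp
  ultimately have "min_ext u (\<psi> i y) = min_ext (best u $ i) y / th u" by (rule LIMSEQ_unique)
  then show "(th u *\<^sub>R bcomp (min_ext u) (\<psi> i)) y = min_ext (best u $ i) y"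
    using th_pos[of u] by simp
qed

end

section \<open>The limit energy\<close>

context scaled_energy
begin

abbreviation en :: "nat \<Rightarrow> ('a \<Rightarrow> real) \<Rightarrow> real" where
  "en n v \<equiv> energy_n P \<psi> n \<sigma> E v"

lemma en_0: "en 0 v = E (restr0 P v)"
  by (simp add: energy_n_def)

text \<open>Splitting off the first letter of each word.\<close>

lemma en_Suc_fun:
  "en (Suc n) v = 1 / \<sigma> * (\<Sum>i\<in>UNIV. en n (\<lambda>x. th (restr0 P v) * v (\<psi> i x)))"
proof -
  define g where "g w = E (theta_word P \<psi> th w v *\<^sub>R restr0 P (v \<circ> word_map \<psi> w))" for w
  have "{w :: 'k list. length w = Suc n} = (\<lambda>(i, w). i # w) ` (UNIV \<times> {w. length w = n})"
    by (auto simp: length_Suc_conv image_iff)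
  then have "(\<Sum>w | length w = Suc n. g w) = (\<Sum>(i, w)\<in>UNIV \<times> {w. length w = n}. g (i # w))"
    by (simp add: sum.reindex inj_on_def case_prod_unfold)
  also have "\<dots> = (\<Sum>i\<in>UNIV. \<Sum>w | length w = n. g (i # w))"
    using finite_lists_length_eq[of "UNIV :: 'k set" n] by (simp add: sum.cartesian_product)
  finally have "(\<Sum>w | length w = Suc n. g w) = (\<Sum>i\<in>UNIV. \<Sum>w | length w = n. g (i # w))" .
  moreover have "g (i # w) = E (theta_word P \<psi> th w (\<lambda>x. th (restr0 P v) * v (\<psi> i x)) *\<^sub>R
      restr0 P ((\<lambda>x. th (restr0 P v) * v (\<psi> i x)) \<circ> word_map \<psi> w))" for i w
    unfolding g_def by (rule arg_cong[of _ _ E]) (simp add: restr0_def vec_eq_iff)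
  ultimately show ?thesis
    using \<sigma>_pos unfolding energy_n_def g_def by (simp add: sum_divide_distrib mult.commute)
qed

lemma en_Suc:
  fixes v :: "'a \<Rightarrow>\<^sub>C real"
  shows "en (Suc n) v = 1 / \<sigma> * (\<Sum>i\<in>UNIV. en n (th (restr0 P v) *\<^sub>R bcomp v (\<psi> i)))"
proof -
  have "apply_bcontfun (th (restr0 P v) *\<^sub>R bcomp v (\<psi> i)) = (\<lambda>x. th (restr0 P v) * v (\<psi> i x))" for i
    by (simp add: fun_eq_iff)
  then show ?thesis by (simp only: en_Suc_fun)
qed

lemma en_nonneg: "0 \<le> en n v"
  unfolding energy_n_def using \<sigma>_pos by (intro mult_nonneg_nonneg sum_nonneg weak_A1D(1)[OF E_weak]) auto

text \<open>By the choice of the scaling factor, one refinement reproduces the energy \<open>E\<close> of the boundary data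
  after minimization.\<close>

lemma en_mono: "en n v \<le> en (Suc n) v" for v :: "'a \<Rightarrow>\<^sub>C real"
proof (induction n arbitrary: v)
  case 0
  define u where "u = restr0 P v"
  have "\<sigma> * E u = renorm E (th u *\<^sub>R u)" by (simp add: renorm_theta_bar[OF E_weak \<sigma>_pos])
  also have "\<dots> \<le> cell_sum E (th u *\<^sub>R cells v)"
    unfolding u_def by (intro renorm_le[OF E_weak] extensions_scaleR cells_in_extensions)
  also have "\<dots> = \<sigma> * en (Suc 0) v"
    unfolding en_Suc en_0 restr0_scaleR restr0_bcomp cell_sum_def u_def vector_scaleR_component
    using \<sigma>_pos by simp
  finally show ?case using \<sigma>_pos by (simp add: en_0 u_def)
next
  case (Suc n)
  show ?case
    unfolding en_Suc[of "Suc n" v] en_Suc[of n v]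
    by (intro mult_left_mono sum_mono Suc) (use \<sigma>_pos in simp)
qed

lemma incseq_en: "incseq (\<lambda>n. ennreal (en n v))" for v :: "'a \<Rightarrow>\<^sub>C real"
  by (rule incseq_SucI) (simp add: ennreal_leI en_mono)

lemma energy_inf_SUP: "energy_inf P \<psi> \<sigma> E v = (SUP n. ennreal (en n v))"
  unfolding energy_inf_def by (rule limI) (rule LIMSEQ_SUP[OF incseq_en])

lemma ennreal_cell_average:
  fixes f :: "'k \<Rightarrow> real"
  assumes "\<And>i. 0 \<le> f i"
  shows "ennreal (1 / \<sigma> * (\<Sum>i\<in>UNIV. f i)) = ennreal (1 / \<sigma>) * (\<Sum>i\<in>UNIV. ennreal (f i))"
proof -
  have "(\<Sum>i\<in>UNIV. ennreal (f i)) = ennreal (\<Sum>i\<in>UNIV. f i)" by (rule sum_ennreal) (rule assms)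
  then show ?thesis using \<sigma>_pos ennreal_mult'[of "1 / \<sigma>" "\<Sum>i\<in>UNIV. f i"] by simp
qed

lemma ennreal_en_Suc:
  fixes v :: "'a \<Rightarrow>\<^sub>C real"
  shows "ennreal (en (Suc n) v) =
    ennreal (1 / \<sigma>) * (\<Sum>i\<in>UNIV. ennreal (en n (th (restr0 P v) *\<^sub>R bcomp v (\<psi> i))))"
  unfolding en_Suc by (rule ennreal_cell_average) (rule en_nonneg)

lemma energy_inf_self_similar:
  "energy_inf P \<psi> \<sigma> E v =
    ennreal (1 / \<sigma>) * (\<Sum>i\<in>UNIV. energy_inf P \<psi> \<sigma> E (th (restr0 P v) *\<^sub>R bcomp v (\<psi> i)))"
proof -
  have "energy_inf P \<psi> \<sigma> E v = (SUP n. ennreal (en (Suc n) v))"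
    unfolding energy_inf_SUP
    by (rule antisym) (auto intro!: SUP_mono exI ennreal_leI en_mono)
  also have "\<dots> = ennreal (1 / \<sigma>) *
      (SUP n. \<Sum>i\<in>UNIV. ennreal (en n (th (restr0 P v) *\<^sub>R bcomp v (\<psi> i))))"
    unfolding ennreal_en_Suc SUP_mult_left_ennreal ..
  also have "\<dots> = ennreal (1 / \<sigma>) * (\<Sum>i\<in>UNIV. energy_inf P \<psi> \<sigma> E (th (restr0 P v) *\<^sub>R bcomp v (\<psi> i)))"
    unfolding energy_inf_SUP by (subst ennreal_SUP_sum) (rule incseq_en refl)+
  finally show ?thesis .
qed

lemma en_min_ext: "en n (min_ext u) = E u"
proof (induction n arbitrary: u)
  case 0
  then show ?case by (simp add: en_0 restr0_min_ext)
next
  case (Suc n)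
  then show ?case unfolding en_Suc restr0_min_ext min_ext_cell using \<sigma>_pos by (simp add: sum_E_best)
qed

text \<open>The extension \<open>min_ext u\<close> has discrete energy \<open>E u\<close> on every level, whereas any extension of \<open>u\<close> has
  discrete energy \<open>E u\<close> on level \<open>0\<close>, a lower bound for its limit energy.\<close>

lemma energy_inf_minimal_extension: "minimal_extension P E (energy_inf P \<psi> \<sigma> E)"
  unfolding minimal_extension_def
proof (intro allI bexI conjI ballI)
  fix u :: "real ^ 'n"
  show "min_ext u \<in> ext_F' P u"
    by (simp add: ext_F'_def ext_F_def restr0_min_ext min_ext_bounds)
  show eq: "ennreal (E u) = energy_inf P \<psi> \<sigma> E (min_ext u)"
    by (simp add: energy_inf_SUP en_min_ext)
  fix w assume "w \<in> ext_F P u"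
  then have "ennreal (E u) = ennreal (en 0 w)" by (simp add: ext_F_def en_0)
  also have "\<dots> \<le> energy_inf P \<psi> \<sigma> E w" unfolding energy_inf_SUP by (rule SUP_upper) simp
  finally show "energy_inf P \<psi> \<sigma> E (min_ext u) \<le> energy_inf P \<psi> \<sigma> E w" using eq by simp
qed

lemma continuous_on_eval: "continuous_on UNIV (\<lambda>v :: 'a \<Rightarrow>\<^sub>C real. v x)"
  by (rule lipschitz_on_continuous_on[of 1], rule lipschitz_onI) (auto simp: dist_bounded)

lemma continuous_on_restr0: "continuous_on UNIV (\<lambda>v :: 'a \<Rightarrow>\<^sub>C real. restr0 P v)"
  unfolding restr0_def by (intro continuous_intros continuous_on_eval)

lemma continuous_on_bcomp: "continuous_on UNIV (\<lambda>v :: 'a \<Rightarrow>\<^sub>C real. bcomp v (\<psi> i))"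
  by (rule lipschitz_on_continuous_on[of 1], rule lipschitz_onI) (auto intro!: dist_bound simp: dist_bounded)

lemma continuous_on_en: "continuous_on UNIV (\<lambda>v :: 'a \<Rightarrow>\<^sub>C real. en n v)"
proof (induction n)
  case 0
  then show ?case unfolding en_0 by (intro continuous_on_weak_A1[OF E_weak] continuous_on_restr0)
next
  case (Suc n)
  have "continuous_on UNIV (\<lambda>v :: 'a \<Rightarrow>\<^sub>C real. th (restr0 P (apply_bcontfun v)))"
    by (rule continuous_on_compose2[OF continuous_th continuous_on_restr0]) simp
  then have "continuous_on UNIV (\<lambda>v :: 'a \<Rightarrow>\<^sub>C real. th (restr0 P (apply_bcontfun v)) *\<^sub>R bcomp v (\<psi> i))" for i
    by (intro continuous_intros continuous_on_bcomp)
  then have "continuous_on UNIV (\<lambda>v :: 'a \<Rightarrow>\<^sub>C real. en n (th (restr0 P (apply_bcontfun v)) *\<^sub>R bcomp v (\<psi> i)))" for i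
    by (rule continuous_on_compose2[OF Suc]) simp
  then show ?case unfolding en_Suc by (intro continuous_intros)
qed

text \<open>A supremum of continuous functionals.\<close>

lemma energy_inf_lsc: "lower_semicontinuous (energy_inf P \<psi> \<sigma> E)"
  unfolding lower_semicontinuous_def le_Liminf_iff
proof (intro allI impI)
  fix v :: "'a \<Rightarrow>\<^sub>C real" and y assume "y < energy_inf P \<psi> \<sigma> E v"
  then obtain n where n: "y < ennreal (en n v)" unfolding energy_inf_SUP less_SUP_iff by blast
  have "((\<lambda>w :: 'a \<Rightarrow>\<^sub>C real. ennreal (en n w)) \<longlongrightarrow> ennreal (en n v)) (at v)"
    using continuous_on_en[of n] by (intro tendsto_ennrealI) (simp add: continuous_on_def)
  from order_tendstoD(1)[OF this n]
  show "\<forall>\<^sub>F w in at v. y < energy_inf P \<psi> \<sigma> E w"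
  proof eventually_elim
    case (elim w)
    also have "ennreal (en n w) \<le> energy_inf P \<psi> \<sigma> E w" unfolding energy_inf_SUP by (rule SUP_upper) simp
    finally show ?case .
  qed
qed

lemma energy_inf_characterizing: "characterizing P \<psi> \<sigma> E (energy_inf P \<psi> \<sigma> E)"
  unfolding characterizing_def self_similar_energy_def
  using energy_inf_lsc energy_inf_self_similar energy_inf_minimal_extension continuous_th th_pos
  by blast

end

section \<open>Uniqueness\<close>

locale characterized_energy = scaled_energy P \<iota> \<psi> E \<sigma>
  for P :: "'n::finite \<Rightarrow> 'a::metric_space" and \<iota> :: "'n \<Rightarrow> 'k::finite" and \<psi> :: "'k \<Rightarrow> 'a \<Rightarrow> 'a"
    and E :: "real ^ 'n \<Rightarrow> real" and \<sigma> :: real +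
  fixes \<E> :: "('a \<Rightarrow>\<^sub>C real) \<Rightarrow> ennreal"
  assumes char: "characterizing P \<psi> \<sigma> E \<E>"
begin

lemma lsc: "\<E> v \<le> Liminf (at v) \<E>"
  using char by (simp add: characterizing_def lower_semicontinuous_def)

definition opt :: "real ^ 'n \<Rightarrow> 'a \<Rightarrow>\<^sub>C real" where
  "opt u = (SOME v. v \<in> ext_F' P u \<and> \<E> v = ennreal (E u))"

lemma opt: "opt u \<in> ext_F' P u" "\<E> (opt u) = ennreal (E u)"
proof -
  have "\<exists>v\<in>ext_F' P u. ennreal (E u) = \<E> v \<and> (\<forall>w\<in>ext_F P u. \<E> v \<le> \<E> w)"
    using char unfolding characterizing_def minimal_extension_def by blast
  then have "\<exists>v. v \<in> ext_F' P u \<and> \<E> v = ennreal (E u)" by metis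
  from someI_ex[OF this] show "opt u \<in> ext_F' P u" "\<E> (opt u) = ennreal (E u)"
    unfolding opt_def by blast+
qed

lemma restr0_opt: "restr0 P (opt u) = u"
  and opt_bounds: "vmin u \<le> opt u x" "opt u x \<le> vmax u"
  using opt(1)[of u] by (auto simp: ext_F'_def ext_F_def)

lemma E_le: "ennreal (E (restr0 P v)) \<le> \<E> v" for v :: "'a \<Rightarrow>\<^sub>C real"
proof -
  obtain w where "ennreal (E (restr0 P v)) = \<E> w" "\<forall>w'\<in>ext_F P (restr0 P v). \<E> w \<le> \<E> w'"
    using char unfolding characterizing_def minimal_extension_def by blast
  then show ?thesis by (simp add: ext_F_def)
qed

text \<open>Minimizing over all extensions of \<open>u\<close> on both sides of the self-similarity relation shows that
  its scaling factor solves the equation that determines \<open>th u\<close>. Continuity settles the constants.\<close>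

lemma scaling_factor_unique:
  assumes cont: "continuous_on UNIV \<theta>" and pos: "\<And>u. 0 < \<theta> u"
    and self: "\<And>v. \<E> v = ennreal (1 / \<sigma>) * (\<Sum>i\<in>UNIV. \<E> (\<theta> (restr0 P v) *\<^sub>R bcomp v (\<psi> i)))"
  shows "\<theta> = th"
proof
  have nonconst: "\<theta> u = th u" if u: "\<not> is_const u" for u
  proof (rule theta_bar_unique[OF E_weak u \<sigma>_pos pos])
    show "renorm E (\<theta> u *\<^sub>R u) = \<sigma> * E u"
    proof (rule antisym)
      define v where "v = opt u"
      have v: "restr0 P v = u" by (simp add: v_def restr0_opt)
      have "ennreal (1 / \<sigma> * renorm E (\<theta> u *\<^sub>R u)) \<le> ennreal (1 / \<sigma> * cell_sum E (\<theta> u *\<^sub>R cells v))"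
        using \<sigma>_pos cells_in_extensions[of v]
        by (intro ennreal_leI mult_left_mono renorm_le[OF E_weak] extensions_scaleR) (auto simp: v)
      also have "\<dots> = ennreal (1 / \<sigma>) * (\<Sum>i\<in>UNIV. ennreal (E (restr0 P (\<theta> u *\<^sub>R bcomp v (\<psi> i)))))"
        unfolding cell_sum_def restr0_scaleR restr0_bcomp vector_scaleR_component
        by (rule ennreal_cell_average) (rule weak_A1D(1)[OF E_weak])
      also have "\<dots> \<le> ennreal (1 / \<sigma>) * (\<Sum>i\<in>UNIV. \<E> (\<theta> u *\<^sub>R bcomp v (\<psi> i)))"
        by (intro mult_left_mono sum_mono E_le) simp
      also have "\<dots> = \<E> v" using self[of v] by (simp add: v)
      also have "\<dots> = ennreal (E u)" by (simp add: v_def opt)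
      finally show "renorm E (\<theta> u *\<^sub>R u) \<le> \<sigma> * E u"
        using \<sigma>_pos weak_A1D(1)[OF E_weak, of u] by (simp add: field_simps)
    next
      obtain W where W: "minimizer E (\<theta> u *\<^sub>R u) W" using minimizer_exists[OF E_weak] by blast
      have W': "(1 / \<theta> u) *\<^sub>R W \<in> extensions u"
        using minimizerD(1)[OF W] pos[of u] extensions_scaleR_iff[of "\<theta> u"] by simp
      define g where "g i = (1 / \<theta> u) *\<^sub>R opt (W $ i)" for i
      have g: "restr0 P (g i) = ((1 / \<theta> u) *\<^sub>R W) $ i" for i
        by (simp only: g_def restr0_scaleR restr0_opt vector_scaleR_component)
      have "ennreal (E u) \<le> \<E> (glue g)"
        using E_le[of "glue g"] glue(2)[OF W' g] by simp
      also have "\<dots> = ennreal (1 / \<sigma>) * (\<Sum>i\<in>UNIV. \<E> (\<theta> u *\<^sub>R g i))"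
        using self[of "glue g"] by (simp add: glue[OF W' g])
      also have "\<dots> = ennreal (1 / \<sigma>) * (\<Sum>i\<in>UNIV. ennreal (E (W $ i)))"
        using pos[of u] by (simp add: g_def opt)
      also have "\<dots> = ennreal (1 / \<sigma> * renorm E (\<theta> u *\<^sub>R u))"
        unfolding renorm_eq[OF W] cell_sum_def
        by (rule ennreal_cell_average[symmetric]) (rule weak_A1D(1)[OF E_weak])
      finally show "\<sigma> * E u \<le> renorm E (\<theta> u *\<^sub>R u)"
        using \<sigma>_pos renorm_nonneg[OF E_weak, of "\<theta> u *\<^sub>R u"] by (simp add: field_simps)
    qed
  qed
  fix u0
  show "\<theta> u0 = th u0"
  proof (cases "is_const u0")
    case False
    then show ?thesis by (rule nonconst)
  next
    case True
    \<comment> \<open>nonconstant vectors converging to the constant \<open>u0\<close>\<close>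
    define z :: "nat \<Rightarrow> real ^ 'n" where "z n = u0 + (1 / real (Suc n)) *\<^sub>R axis undefined 1" for n
    have "(\<lambda>n. 1 / real (Suc n)) \<longlonglongrightarrow> 0" by (rule LIMSEQ_Suc[OF lim_1_over_n])
    then have "z \<longlonglongrightarrow> u0 + 0 *\<^sub>R axis undefined 1" unfolding z_def by (intro tendsto_intros)
    then have z: "z \<longlonglongrightarrow> u0" by simp
    have "(\<lambda>n. \<theta> (z n)) \<longlonglongrightarrow> \<theta> u0" "(\<lambda>n. th (z n)) \<longlonglongrightarrow> th u0"
      by (rule continuous_on_tendsto_compose[OF cont z] continuous_on_tendsto_compose[OF continuous_th z]; simp)+
    moreover have "\<theta> (z n) = th (z n)" for n
    proof (rule nonconst)
      obtain c where c: "u0 = vec c" using True by (auto simp: is_const_def)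
      have "osc (z n) = osc ((1 / real (Suc n)) *\<^sub>R (axis undefined 1 :: real ^ 'n))"
        unfolding z_def c by (subst add.commute) (rule osc_add_vec)
      then show "\<not> is_const (z n)"
        by (simp add: is_const_iff_osc osc_scaleR) (simp add: is_const_axis flip: is_const_iff_osc)
    qed
    ultimately show ?thesis using LIMSEQ_unique by simp
  qed
qed

lemma self_similar:
  "\<E> v = ennreal (1 / \<sigma>) * (\<Sum>i\<in>UNIV. \<E> (th (restr0 P v) *\<^sub>R bcomp v (\<psi> i)))"
proof -
  obtain \<theta> where \<theta>: "continuous_on UNIV \<theta>" "\<And>u. 0 < \<theta> u"
    "\<And>v. \<E> v = ennreal (1 / \<sigma>) * (\<Sum>i\<in>UNIV. \<E> (\<theta> (restr0 P v) *\<^sub>R bcomp v (\<psi> i)))"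
    using char unfolding characterizing_def self_similar_energy_def by metis
  then have "\<theta> = th" by (rule scaling_factor_unique)
  with \<theta>(3) show ?thesis by metis
qed

lemma en_le: "ennreal (en n v) \<le> \<E> v" for v :: "'a \<Rightarrow>\<^sub>C real"
proof (induction n arbitrary: v)
  case 0
  then show ?case by (simp add: en_0 E_le)
next
  case (Suc n)
  show ?case
    unfolding ennreal_en_Suc self_similar[of v] by (intro mult_left_mono sum_mono Suc) simp
qed

text \<open>The function \<open>cell_opt n v\<close> keeps the values of \<open>v\<close> at the vertices of the cells of level \<open>n\<close>
  and minimizes \<open>\<E>\<close> inside these cells; its energy is therefore the discrete energy of \<open>v\<close>.\<close>

primrec cell_opt :: "nat \<Rightarrow> ('a \<Rightarrow>\<^sub>C real) \<Rightarrow> 'a \<Rightarrow>\<^sub>C real" where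
  "cell_opt 0 v = opt (restr0 P v)"
| "cell_opt (Suc n) v = glue (\<lambda>i. (1 / th (restr0 P v)) *\<^sub>R cell_opt n (th (restr0 P v) *\<^sub>R bcomp v (\<psi> i)))"

lemma restr0_cell_opt_pieces:
  fixes v :: "'a \<Rightarrow>\<^sub>C real"
  assumes "\<And>w :: 'a \<Rightarrow>\<^sub>C real. restr0 P (cell_opt n w) = restr0 P w"
  shows "restr0 P ((1 / th (restr0 P v)) *\<^sub>R cell_opt n (th (restr0 P v) *\<^sub>R bcomp v (\<psi> i))) = cells v $ i"
  unfolding restr0_scaleR assms restr0_bcomp using th_pos[of "restr0 P v"] by simp

lemma restr0_cell_opt: "restr0 P (cell_opt n v) = restr0 P v" for v :: "'a \<Rightarrow>\<^sub>C real"
proof (induction n arbitrary: v)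
  case 0
  then show ?case by (simp add: restr0_opt)
next
  case (Suc n)
  show ?case unfolding cell_opt.simps
    by (rule glue(2)[OF cells_in_extensions restr0_cell_opt_pieces[OF Suc]])
qed

lemma bcomp_cell_opt:
  "th (restr0 P v) *\<^sub>R bcomp (cell_opt (Suc n) v) (\<psi> i) = cell_opt n (th (restr0 P v) *\<^sub>R bcomp v (\<psi> i))"
  for v :: "'a \<Rightarrow>\<^sub>C real"
  unfolding cell_opt.simps
  using th_pos[of "restr0 P v"]
  by (simp add: glue(1)[OF cells_in_extensions restr0_cell_opt_pieces[OF restr0_cell_opt]])

lemma energy_cell_opt: "\<E> (cell_opt n v) = ennreal (en n v)" for v :: "'a \<Rightarrow>\<^sub>C real"
proof (induction n arbitrary: v)
  case 0
  then show ?case by (simp add: opt en_0)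
next
  case (Suc n)
  show ?case
    unfolding ennreal_en_Suc self_similar[of "cell_opt (Suc n) v"] restr0_cell_opt bcomp_cell_opt Suc ..
qed

text \<open>On a cell of level \<open>n\<close> the function \<open>cell_opt n v\<close> lies between two values of \<open>v\<close> at vertices of that
  cell, whose diameter is at most \<open>B / 2 ^ n\<close>.\<close>

lemma cell_opt_close:
  fixes v :: "'a \<Rightarrow>\<^sub>C real"
  assumes "\<And>y z :: 'a. dist y z \<le> B"
    and "\<And>y z. dist y z \<le> B / 2 ^ n \<Longrightarrow> \<bar>v y - v z\<bar> \<le> e"
  shows "\<bar>cell_opt n v x - v x\<bar> \<le> e"
  using assms(2)
proof (induction n arbitrary: v e x)
  case 0
  then have close: "\<bar>v y - v z\<bar> \<le> e" for y z using assms(1) by simp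
  obtain a b where ab: "restr0 P v $ a = vmin (restr0 P v)" "restr0 P v $ b = vmax (restr0 P v)"
    using vmin_attained vmax_attained by metis
  have "v (P a) \<le> cell_opt 0 v x" "cell_opt 0 v x \<le> v (P b)"
    using opt_bounds[where u = "restr0 P v" and x = x] ab by (auto simp: restr0_def)
  then show ?case using close[of "P a" x] close[of "P b" x] by (simp add: abs_le_iff)
next
  case (Suc n)
  define t where "t = th (restr0 P v)"
  have t: "0 < t" unfolding t_def by (rule th_pos)
  obtain i y where x: "x = \<psi> i y" using in_some_cell by blast
  define w where "w = t *\<^sub>R bcomp v (\<psi> i)"
  have "\<bar>w y - w z\<bar> \<le> t * e" if "dist y z \<le> B / 2 ^ n" for y z
  proof -
    have "\<bar>v (\<psi> i y) - v (\<psi> i z)\<bar> \<le> e"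
      by (rule Suc.prems) (use that in \<open>simp add: dist_\<psi> field_simps\<close>)
    then show ?thesis using t by (simp add: w_def abs_mult flip: right_diff_distrib)
  qed
  then have "\<bar>cell_opt n w y - w y\<bar> \<le> t * e" by (rule Suc.IH)
  moreover have "cell_opt n w y = t * cell_opt (Suc n) v x"
    using arg_cong[OF bcomp_cell_opt[of v n i], of "\<lambda>f. apply_bcontfun f y"]
    unfolding w_def t_def x by (simp del: cell_opt.simps)
  moreover have "w y = t * v x" by (simp add: w_def x)
  ultimately have "t * \<bar>cell_opt (Suc n) v x - v x\<bar> \<le> t * e"
    using t by (simp add: abs_mult flip: right_diff_distrib)
  then show ?case using t by simp
qed

lemma cell_opt_tendsto: "(\<lambda>n. cell_opt n v) \<longlonglongrightarrow> v"
proof (rule metric_LIMSEQ_I)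
  fix r :: real assume r: "0 < r"
  have "uniformly_continuous_on UNIV v" by (rule compact_uniformly_continuous[OF _ compact_space]) simp
  then obtain \<delta> where \<delta>: "0 < \<delta>" "\<And>y z. dist y z < \<delta> \<Longrightarrow> dist (v y) (v z) < r / 2"
    unfolding uniformly_continuous_on_def using r by (metis UNIV_I half_gt_zero)
  have "bounded (UNIV :: 'a set)" by (rule compact_imp_bounded[OF compact_space])
  then obtain B where B: "\<And>y z :: 'a. dist y z \<le> B"
    unfolding bounded_two_points by blast
  have "(\<lambda>n. B * (1 / 2) ^ n) \<longlonglongrightarrow> 0"
    by (intro tendsto_mult_right_zero LIMSEQ_power_zero) simp
  then have "\<forall>\<^sub>F n in sequentially. B * (1 / 2) ^ n < \<delta>" using \<delta>(1) by (rule order_tendstoD)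
  then obtain M where M: "\<And>n. M \<le> n \<Longrightarrow> B * (1 / 2) ^ n < \<delta>" by (auto simp: eventually_sequentially)
  have "dist (cell_opt n v) v < r" if "M \<le> n" for n
  proof -
    have "dist (cell_opt n v) v \<le> r / 2"
    proof (rule dist_bound)
      fix x
      have "\<bar>cell_opt n v x - v x\<bar> \<le> r / 2"
      proof (rule cell_opt_close[OF B])
        fix y z :: 'a assume "dist y z \<le> B / 2 ^ n"
        then have "dist y z < \<delta>" using M[OF that] by (simp add: power_divide)
        then show "\<bar>v y - v z\<bar> \<le> r / 2" using \<delta>(2) by (fastforce simp: dist_real_def)
      qed
      then show "dist (cell_opt n v x) (v x) \<le> r / 2" by (simp add: dist_real_def)
    qed
    then show ?thesis using r by simp
  qed
  then show "\<exists>M. \<forall>n\<ge>M. dist (cell_opt n v) v < r" by blast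
qed

lemma energy_unique: "\<E> = energy_inf P \<psi> \<sigma> E"
proof
  fix v
  show "\<E> v = energy_inf P \<psi> \<sigma> E v"
  proof (rule antisym)
    show "energy_inf P \<psi> \<sigma> E v \<le> \<E> v"
      unfolding energy_inf_SUP by (rule SUP_least) (rule en_le)
    show "\<E> v \<le> energy_inf P \<psi> \<sigma> E v"
    proof (rule dense_le)
      fix y assume y: "y < \<E> v"
      then have "\<forall>\<^sub>F w in at v. y < \<E> w" using lsc[of v] by (simp add: le_Liminf_iff)
      then have "\<forall>\<^sub>F w in nhds v. y < \<E> w" using y by (auto simp: eventually_nhds_conv_at)
      then have "\<forall>\<^sub>F n in sequentially. y < \<E> (cell_opt n v)"
        using cell_opt_tendsto by (auto simp: filterlim_iff)
      then obtain n where "y < \<E> (cell_opt n v)" by (auto simp: eventually_sequentially)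
      also have "\<dots> = ennreal (en n v)" by (rule energy_cell_opt)
      also have "\<dots> \<le> energy_inf P \<psi> \<sigma> E v" unfolding energy_inf_SUP by (rule SUP_upper) simp
      finally show "y \<le> energy_inf P \<psi> \<sigma> E v" by simp
    qed
  qed
qed

end

theorem theorem6p2:
  fixes P :: "'n::finite \<Rightarrow> 'a::metric_space"
    and \<iota> :: "'n \<Rightarrow> 'k::finite"
    and \<psi> :: "'k \<Rightarrow> 'a \<Rightarrow> 'a"
    and E :: "real ^ 'n \<Rightarrow> real"
    and \<sigma> :: real
  assumes "fractal P \<iota> \<psi>"
    and "E \<in> class_A4 P \<psi>"
    and "0 < \<sigma>" and "\<sigma> \<le> 1"
  shows "characterizing P \<psi> \<sigma> E (energy_inf P \<psi> \<sigma> E) \<and>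
    (\<forall>\<E>. characterizing P \<psi> \<sigma> E \<E> \<longrightarrow> \<E> = energy_inf P \<psi> \<sigma> E)"
proof -
  interpret scaled_energy P \<iota> \<psi> E \<sigma>
    using assms by (simp add: scaled_energy_def scaled_energy_axioms_def)
  have "\<E> = energy_inf P \<psi> \<sigma> E" if "characterizing P \<psi> \<sigma> E \<E>" for \<E>
  proof -
    interpret characterized_energy P \<iota> \<psi> E \<sigma> \<E>
      by unfold_locales (rule that)
    show ?thesis by (rule energy_unique)
  qed
  then show ?thesis using energy_inf_characterizing by blast
qed

end
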